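(* Let $\{\rho_n\}\subset\mathcal P(\mathbb R^3)$ be such that $\rho_n\stackrel{*}{\rightharpoonup}\rho$, where $\rho\in\mathcal P(\mathbb R^3)$ satisfies $\lim_{r\to0}\mu_\rho(r)<\frac{1}{N(N-1)^2}$. Assume that $\phi$ is of class $\mathcal C^1$ and that for all $t>0$ there exists a constant $k(t)$ such that $|\phi'(s)|<k(t)$ for all $s>t$. Then $$C(\rho_n)\to C(\rho)\qquad\text{as }n\to+\infty.$$
   Context: $N>1$ is an integer and $d=3$; $\mathcal P(X)$ is the set of Borel probability measures on $X$. The convergence $\rho_n\stackrel{*}{\rightharpoonup}\rho$ is the tight (narrow) convergence of probability measures, i.e. $\int f\,d\rho_n\to\int f\,d\rho$ for all bounded continuous $f$. The function $\phi:(0,+\infty)\to[0,+\infty)$ is continuous, strictly decreasing, and $\lim_{t\to0^+}\phi(t)=+\infty$; by convention $\phi(0)=+\infty$. The cost is $c(x_1,\dots,x_N)=\sum_{1\le i<j\le N}\phi(|x_i-x_j|)$ for $x_1,\dots,x_N\in\mathbb R^d$. $\Pi(\rho)$ is the set of $P\in\mathcal P(\mathbb R^{Nd})$ all of whose $N$ marginals on the factors $\mathbb R^d$ are equal to $\rho$, and $C(\rho)=\min_{P\in\Pi(\rho)}\int c\,dP\in[0,+\infty]$. Measure of concentration: $\mu_\rho(r)=\sup_{x\in\mathbb R^d}\rho(B(x,r))$, with $B(x,r)$ the open ball. *)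

theory Defs
  imports "HOL-Probability.Probability"
begin

abbreviation borel_probs :: "'a::topological_space measure set" where
  "borel_probs \<equiv> space (prob_algebra borel)"

definition narrowly_converges ::
    "(nat \<Rightarrow> 'a::topological_space measure) \<Rightarrow> 'a measure \<Rightarrow> bool" where
  "narrowly_converges \<rho>s \<rho> \<longleftrightarrow>
     (\<forall>f::'a \<Rightarrow> real. continuous_on UNIV f \<and> bounded (range f) \<longrightarrow>
        (\<lambda>n. \<integral>x. f x \<partial>(\<rho>s n)) \<longlonglongrightarrow> (\<integral>x. f x \<partial>\<rho>))"

text \<open>The convention $\phi(0) = +\infty$ is imposed here, so the value of the real function
  \<open>\<phi>\<close> at \<open>0\<close> (and at negative arguments) is irrelevant.\<close>

definition extended_potential :: "(real \<Rightarrow> real) \<Rightarrow> real \<Rightarrow> ennreal" where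
  "extended_potential \<phi> t = (if t = 0 then \<infinity> else ennreal (\<phi> t))"

text \<open>Configurations of \<open>N\<close> points are functions on the index set \<open>{..<N}\<close> (indices
  \<open>0, \<dots>, N - 1\<close>). The product \<open>\<sigma>\<close>-algebra \<open>\<Pi>\<^sub>M i\<in>{..<N}. borel\<close> is the Borel
  \<open>\<sigma>\<close>-algebra of the \<open>N\<close>-fold power, since the factors are second countable.\<close>

definition cost :: "(real \<Rightarrow> real) \<Rightarrow> nat \<Rightarrow> (nat \<Rightarrow> 'a::euclidean_space) \<Rightarrow> ennreal" where
  "cost \<phi> N x = (\<Sum>j<N. \<Sum>i<j. extended_potential \<phi> (norm (x i - x j)))"

definition transport_plans ::
    "nat \<Rightarrow> 'a::euclidean_space measure \<Rightarrow> (nat \<Rightarrow> 'a) measure set" where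
  "transport_plans N \<rho> =
     {P \<in> space (prob_algebra (\<Pi>\<^sub>M i\<in>{..<N}. borel)). \<forall>i<N. distr P borel (\<lambda>x. x i) = \<rho>}"

text \<open>The minimal cost, written as an infimum in \<open>[0, \<infinity>]\<close>: it is attained by lower
  semicontinuity of the cost and narrow compactness of the set of plans.\<close>

definition optimal_cost ::
    "(real \<Rightarrow> real) \<Rightarrow> nat \<Rightarrow> 'a::euclidean_space measure \<Rightarrow> ennreal" where
  "optimal_cost \<phi> N \<rho> = (INF P\<in>transport_plans N \<rho>. \<integral>\<^sup>+x. cost \<phi> N x \<partial>P)"

definition concentration :: "'a::metric_space measure \<Rightarrow> real \<Rightarrow> real" where
  "concentration \<rho> r = (SUP x. measure \<rho> (ball x r))"

end

theory Submission
  imports Defs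
begin

text \<open>Neither duality nor compactness of plans is needed: plans are compared directly.
  Fix a finite continuous partition of unity with small supports, one of its members living near
  infinity. A plan becomes a family of weights on tuples of cells, whose marginals are the masses
  of the cells; conversely such weights, multiplied with the product measure, give a plan for any
  measure with these cell masses. Narrow convergence makes the cell masses of \<open>\<rho>s n\<close> and \<open>\<rho>\<close>
  close. So take a plan for one of the two measures, keep a fraction \<open>1 - \<theta>\<close> of its weights on
  tuples with well separated cells, and complete the missing marginals. They have mass about \<open>\<theta>\<close>
  and are no more concentrated than \<open>\<rho>\<close>, hence can be filled by weights on tuples at mutual
  distance at least \<open>r\<close>, where \<open>r\<close> depends on \<open>\<rho>\<close> only; this costs \<open>O(\<theta>)\<close>. The construction is
  symmetric in the two measures, so it bounds each optimal cost by the other.\<close>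

subsection \<open>Weights on tuples with prescribed marginals\<close>

text \<open>The obstacle is the singularity of the cost: a correction of tiny mass can have infinite
  cost if that mass is concentrated, and nothing is known about the shape of the difference of two
  marginals. Scaling the kept weights by 1 - \<theta> mixes a share \<theta> of the target measure
  into the residue. All other errors are made small compared with \<theta>, so the residue divided
  by its mass is almost as spread out as the target. The bound N^2 * \<phi>(r) on the cost of the
  filling is fixed before \<theta> is chosen. The filling exists as soon as neighbourhoods of cells
  have mass at most \<kappa> with 2 (N - 1) \<kappa> < 1: an exchange of one coordinate between two
  tuples can fail for 2 (N - 1) reasons, each of mass at most \<kappa>. Tuples of cells without a
  well separated configuration have small weight by Markov's inequality. On the others the cost is
  Lipschitz, so it varies little over a product of small cells.\<close>

abbreviation tuples :: "nat \<Rightarrow> 'k set \<Rightarrow> (nat \<Rightarrow> 'k) set" where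
  "tuples N K \<equiv> {..<N} \<rightarrow>\<^sub>E K"

text \<open>A discrete transport plan whose total mass is not normalised. The marginal may depend on
  the coordinate: dropping part of a plan spoils the equality of its marginals, and so does the
  residue that has to be filled. Values off \<open>tuples N K\<close> are left free.\<close>

definition weights :: "nat \<Rightarrow> 'k set \<Rightarrow> (nat \<Rightarrow> 'k \<Rightarrow> real) \<Rightarrow> ((nat \<Rightarrow> 'k) \<Rightarrow> real) set" where
  "weights N K p = {w. (\<forall>t\<in>tuples N K. 0 \<le> w t) \<and>
     (\<forall>i<N. \<forall>a\<in>K. (\<Sum>t | t \<in> tuples N K \<and> t i = a. w t) = p i a)}"

text \<open>Pairs are ordered, so a symmetric \<open>E\<close> counts each conflict twice; only
  comparisons of cardinalities matter. Distinct indices with the same cell conflict when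
  \<open>E\<close> is reflexive at that cell.\<close>

definition conflicts :: "nat \<Rightarrow> ('k \<Rightarrow> 'k \<Rightarrow> bool) \<Rightarrow> (nat \<Rightarrow> 'k) \<Rightarrow> (nat \<times> nat) set" where
  "conflicts N E t = {(i, j). i < N \<and> j < N \<and> i \<noteq> j \<and> E (t i) (t j)}"

lemma sum_UN_le:
  fixes f :: "'b \<Rightarrow> real"
  assumes "finite J" "\<And>j. j \<in> J \<Longrightarrow> finite (A j)" "\<And>x. x \<in> (\<Union>j\<in>J. A j) \<Longrightarrow> 0 \<le> f x"
  shows "sum f (\<Union>j\<in>J. A j) \<le> (\<Sum>j\<in>J. sum f (A j))"
  using assms
proof (induction J)
  case (insert j J)
  have "sum f (A j \<union> (\<Union>j\<in>J. A j)) + sum f (A j \<inter> (\<Union>j\<in>J. A j)) = sum f (A j) + sum f (\<Union>j\<in>J. A j)"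
    using insert by (intro sum.union_inter) auto
  moreover have "0 \<le> sum f (A j \<inter> (\<Union>j\<in>J. A j))"
    using insert by (intro sum_nonneg) auto
  ultimately show ?case using insert by simp
qed simp

lemma finite_tuples: "finite K \<Longrightarrow> finite (tuples N K)"
  by (simp add: finite_PiE)

lemma finite_conflicts: "finite (conflicts N E t)"
  by (rule finite_subset[of _ "{..<N} \<times> {..<N}"]) (auto simp: conflicts_def)

text \<open>A value \<open>b\<close> compatible with all other entries removes every pair that
  involves \<open>i\<close> and leaves the rest as it was. Excluding the pairs with first index
  \<open>i\<close> is enough for a strict decrease of the count.\<close>

lemma conflicts_upd_subset:
  assumes "\<And>j. j < N \<Longrightarrow> j \<noteq> i \<Longrightarrow> \<not> E b (t j)" "\<And>j. j < N \<Longrightarrow> j \<noteq> i \<Longrightarrow> \<not> E (t j) b"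
  shows "conflicts N E (t(i := b)) \<subseteq> {(j, k) \<in> conflicts N E t. j \<noteq> i}"
proof
  fix x assume x: "x \<in> conflicts N E (t(i := b))"
  obtain j k where "x = (j, k)" by (cases x)
  with x show "x \<in> {(j, k) \<in> conflicts N E t. j \<noteq> i}"
    using assms by (cases "j = i"; cases "k = i") (auto simp: conflicts_def)
qed

text \<open>Tuples are grouped by their \<open>i\<close>-th entry. The semiring is general because
  the identity serves both real weights and integrals in \<open>ennreal\<close>.\<close>

lemma sum_tuples_coordinate:
  fixes g :: "'k \<Rightarrow> 'c::comm_semiring_0"
  assumes "finite K" "i < N"
  shows "(\<Sum>t\<in>tuples N K. w t * g (t i)) = (\<Sum>a\<in>K. (\<Sum>t | t \<in> tuples N K \<and> t i = a. w t) * g a)"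
proof -
  have "(\<Sum>t\<in>tuples N K. w t * g (t i))
      = (\<Sum>a\<in>K. \<Sum>t | t \<in> tuples N K \<and> t i = a. w t * g (t i))"
    by (rule sum.group[symmetric]) (use assms in \<open>auto simp: finite_tuples\<close>)
  also have "\<dots> = (\<Sum>a\<in>K. (\<Sum>t | t \<in> tuples N K \<and> t i = a. w t) * g a)"
    by (intro sum.cong) (auto simp: sum_distrib_right)
  finally show ?thesis .
qed

lemma weights_nonneg: "w \<in> weights N K p \<Longrightarrow> t \<in> tuples N K \<Longrightarrow> 0 \<le> w t"
  by (auto simp: weights_def)

lemma weights_marginal:
  "w \<in> weights N K p \<Longrightarrow> i < N \<Longrightarrow> a \<in> K \<Longrightarrow> (\<Sum>t | t \<in> tuples N K \<and> t i = a. w t) = p i a"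
  by (auto simp: weights_def)

lemma weights_le_marginal:
  assumes "w \<in> weights N K p" "finite K" "i < N" "t \<in> tuples N K"
  shows "w t \<le> p i (t i)"
proof -
  have "w t \<le> (\<Sum>s | s \<in> tuples N K \<and> s i = t i. w s)"
    using assms finite_tuples[of K N] by (intro member_le_sum) (auto dest: weights_nonneg)
  also have "\<dots> = p i (t i)"
    using assms by (intro weights_marginal) (auto simp: PiE_iff)
  finally show ?thesis .
qed

lemma weights_sum_coordinate:
  fixes g :: "'k \<Rightarrow> real"
  assumes "w \<in> weights N K p" "finite K" "i < N"
  shows "(\<Sum>t\<in>tuples N K. w t * g (t i)) = (\<Sum>a\<in>K. p i a * g a)"
  using assms by (simp add: sum_tuples_coordinate weights_marginal)

lemma weights_total:
  assumes "w \<in> weights N K p" "finite K" "i < N"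
  shows "(\<Sum>t\<in>tuples N K. w t) = (\<Sum>a\<in>K. p i a)"
  using weights_sum_coordinate[OF assms, of "\<lambda>_. 1"] by simp

lemma weights_sum_subset:
  assumes "w \<in> weights N K p" "finite K" "i < N" "B \<subseteq> K"
  shows "(\<Sum>t | t \<in> tuples N K \<and> t i \<in> B. w t) = (\<Sum>a\<in>B. p i a)"
proof -
  have "(\<Sum>t | t \<in> tuples N K \<and> t i \<in> B. w t) = (\<Sum>t\<in>tuples N K. w t * of_bool (t i \<in> B))"
    by (intro sum.mono_neutral_cong_left) (auto simp: finite_tuples assms)
  also have "\<dots> = (\<Sum>a\<in>K. p i a * of_bool (a \<in> B))"
    using assms by (intro weights_sum_coordinate)
  also have "\<dots> = (\<Sum>a\<in>B. p i a)"
    by (intro sum.mono_neutral_cong_right) (use assms in auto)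
  finally show ?thesis .
qed

lemma weights_add:
  assumes "v \<in> weights N K p" "w \<in> weights N K q"
  shows "(\<lambda>t. v t + w t) \<in> weights N K (\<lambda>i a. p i a + q i a)"
  using assms by (auto simp: weights_def sum.distrib)

text \<open>The fibre \<open>t i = a\<close> is again a product set, with the \<open>i\<close>-th
  factor shrunk to \<open>{a}\<close>, so the sum of products factors.\<close>

lemma sum_prod_tuples_fix:
  fixes f :: "nat \<Rightarrow> 'k \<Rightarrow> 'c::comm_semiring_1"
  assumes "finite K" "i < N" "a \<in> K"
  shows "(\<Sum>t | t \<in> tuples N K \<and> t i = a. \<Prod>j<N. f j (t j))
       = f i a * (\<Prod>j\<in>{..<N} - {i}. \<Sum>b\<in>K. f j b)"
proof -
  let ?K = "\<lambda>j. if j = i then {a} else K"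
  have "{t. t \<in> tuples N K \<and> t i = a} = PiE {..<N} ?K"
  proof (intro set_eqI iffI CollectI conjI)
    fix t assume t: "t \<in> {t. t \<in> tuples N K \<and> t i = a}"
    then show "t \<in> PiE {..<N} ?K"
      by (simp add: PiE_iff)
  next
    fix t assume t: "t \<in> PiE {..<N} ?K"
    show "t i = a"
      using PiE_mem[OF t, of i] assms(2) by simp
    have "t j \<in> K" if "j < N" for j
      using PiE_mem[OF t, of j] that assms(3) by (cases "j = i") simp_all
    moreover have "t \<in> extensional {..<N}"
      using t by (simp add: PiE_iff)
    ultimately show "t \<in> tuples N K"
      by (simp add: PiE_iff)
  qed
  then have "(\<Sum>t | t \<in> tuples N K \<and> t i = a. \<Prod>j<N. f j (t j)) = (\<Prod>j<N. \<Sum>b\<in>?K j. f j b)"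
    using assms by (simp add: prod_sum_PiE)
  also have "\<dots> = (\<Sum>b\<in>?K i. f i b) * (\<Prod>j\<in>{..<N} - {i}. \<Sum>b\<in>?K j. f j b)"
    using assms by (intro prod.remove) auto
  also have "\<dots> = f i a * (\<Prod>j\<in>{..<N} - {i}. \<Sum>b\<in>K. f j b)"
    by (simp cong: prod.cong_simp)
  finally show ?thesis .
qed

text \<open>The independent coupling, rescaled to total mass \<open>m\<close>; it witnesses that the
  set of weights is nonempty.\<close>

lemma product_in_weights:
  assumes "finite K" "N > 0" "m > 0"
    and "\<And>i a. i < N \<Longrightarrow> a \<in> K \<Longrightarrow> 0 \<le> p i a"
    and "\<And>i. i < N \<Longrightarrow> (\<Sum>a\<in>K. p i a) = m"
  shows "(\<lambda>t. m * (\<Prod>j<N. p j (t j) / m)) \<in> weights N K p"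
proof -
  have "(\<Sum>t | t \<in> tuples N K \<and> t i = a. m * (\<Prod>j<N. p j (t j) / m)) = p i a"
    if "i < N" "a \<in> K" for i a
  proof -
    have "(\<Sum>t | t \<in> tuples N K \<and> t i = a. m * (\<Prod>j<N. p j (t j) / m))
        = m * (p i a / m * (\<Prod>j\<in>{..<N} - {i}. \<Sum>b\<in>K. p j b / m))"
      unfolding sum_distrib_left[symmetric]
      using sum_prod_tuples_fix[OF assms(1) that, of "\<lambda>j b. p j b / m"] by simp
    also have "(\<Prod>j\<in>{..<N} - {i}. \<Sum>b\<in>K. p j b / m) = 1"
      by (intro prod.neutral) (use assms in \<open>auto simp: sum_divide_distrib[symmetric]\<close>)
    finally show ?thesis using assms by simp
  qed
  moreover have "0 \<le> m * (\<Prod>j<N. p j (t j) / m)" if "t \<in> tuples N K" for t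
    using that assms by (auto intro!: mult_nonneg_nonneg prod_nonneg simp: PiE_iff)
  ultimately show ?thesis by (auto simp: weights_def)
qed

section \<open>Compactness of the set of weights and the exchange argument\<close>

lemma compact_function_box:
  fixes C :: "'i \<Rightarrow> 'b::topological_space set"
  assumes "\<And>i. compact (C i)"
  shows "compact (PiE UNIV C)"
  using compactin_PiE[of "\<lambda>_. euclidean" UNIV C] assms
  by (auto simp: euclidean_product_topology compactin_euclidean_iff)

text \<open>Weights must vanish off the tuples here, since \<open>weights\<close> leaves them free
  there and compactness would fail. Each weight is at most its marginal in coordinate 0, so
  \<open>m\<close> gives a box, compact by Tychonoff, which is cut by closed linear
  conditions.\<close>

lemma compact_weights:
  assumes "finite K" "N > 0" "\<And>a. a \<in> K \<Longrightarrow> p 0 a \<le> m"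
  shows "compact {w \<in> weights N K p. \<forall>t. t \<notin> tuples N K \<longrightarrow> w t = 0}"
proof -
  let ?T = "tuples N K"
  let ?B = "PiE UNIV (\<lambda>t. if t \<in> ?T then {0..m} else {0::real})"
  let ?C = "\<Inter>i\<in>{..<N}. \<Inter>a\<in>K. {w. (\<Sum>t | t \<in> ?T \<and> t i = a. w t) = p i a}"
  have C: "w \<in> ?C \<longleftrightarrow> (\<forall>i<N. \<forall>a\<in>K. (\<Sum>t | t \<in> ?T \<and> t i = a. w t) = p i a)" for w
    by auto
  have eq: "{w \<in> weights N K p. \<forall>t. t \<notin> ?T \<longrightarrow> w t = 0} = ?B \<inter> ?C"
  proof (intro set_eqI iffI)
    fix w assume w: "w \<in> {w \<in> weights N K p. \<forall>t. t \<notin> ?T \<longrightarrow> w t = 0}"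
    have "w t \<le> m" if "t \<in> ?T" for t
    proof -
      have "w t \<le> p 0 (t 0)"
        by (rule weights_le_marginal[of w N K p 0 t]) (use w assms(1,2) that in simp_all)
      also have "\<dots> \<le> m" using assms(2) by (intro assms(3) PiE_mem[OF that]) simp
      finally show ?thesis .
    qed
    moreover have "0 \<le> w t" if "t \<in> ?T" for t
      using w that by (simp add: weights_def)
    ultimately have "w \<in> ?B" using w by (intro PiE_I) simp_all
    moreover have "w \<in> ?C" unfolding C using w by (simp add: weights_def)
    ultimately show "w \<in> ?B \<inter> ?C" by (rule IntI)
  next
    fix w assume w: "w \<in> ?B \<inter> ?C"
    have *: "w t \<in> (if t \<in> ?T then {0..m} else {0})" for t
      by (rule PiE_mem[OF IntD1[OF w] UNIV_I])
    have "0 \<le> w t" for t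
      using *[of t] by (cases "t \<in> ?T") (simp_all only: if_True if_False atLeastAtMost_iff singleton_iff order_refl)
    moreover have "w t = 0" if "t \<notin> ?T" for t
      using *[of t] that by (simp only: if_False singleton_iff)
    moreover note IntD2[OF w, unfolded C]
    ultimately show "w \<in> {w \<in> weights N K p. \<forall>t. t \<notin> ?T \<longrightarrow> w t = 0}"
      by (simp add: weights_def)
  qed
  have "compact ?B"
    by (intro compact_function_box) auto
  moreover have "closed ?C"
    by (intro closed_INT ballI closed_Collect_eq continuous_intros continuous_on_sum
        continuous_on_product_coordinates)
  ultimately show ?thesis unfolding eq by (rule compact_Int_closed)
qed

text \<open>Among the weights with the given marginals, choose one with the least expected number of
  conflicts. If a conflicting tuple carried weight, most of the mass would sit on tuples with
  which one of its coordinates can be exchanged without creating conflicts.\<close>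

lemma conflict_free_weights:
  fixes p :: "nat \<Rightarrow> 'k \<Rightarrow> real"
  assumes K: "finite K" and N: "N > 0" and m: "m > 0"
    and p0: "\<And>i a. i < N \<Longrightarrow> a \<in> K \<Longrightarrow> 0 \<le> p i a"
    and pm: "\<And>i. i < N \<Longrightarrow> (\<Sum>a\<in>K. p i a) = m"
    and E: "\<And>a b. E a b \<Longrightarrow> E b a"
    and \<kappa>: "\<And>i a. i < N \<Longrightarrow> a \<in> K \<Longrightarrow> (\<Sum>b | b \<in> K \<and> E a b. p i b) \<le> \<kappa> * m"
    and small: "2 * (real N - 1) * \<kappa> < 1"
  shows "\<exists>w\<in>weights N K p. \<forall>t\<in>tuples N K. 0 < w t \<longrightarrow> conflicts N E t = {}"
proof -
  let ?T = "tuples N K"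
  let ?S = "{w \<in> weights N K p. \<forall>t. t \<notin> ?T \<longrightarrow> w t = 0}"
  let ?cf = "\<lambda>t. real (card (conflicts N E t))"
  have fT: "finite ?T" using K by (rule finite_tuples)
  have "compact ?S"
  proof (rule compact_weights[OF K N])
    show "p 0 a \<le> m" if "a \<in> K" for a
      using member_le_sum[of a K "p 0"] that p0 pm[of 0] K N by auto
  qed
  moreover have "(\<lambda>t. if t \<in> ?T then m * (\<Prod>j<N. p j (t j) / m) else 0) \<in> ?S"
    using product_in_weights[OF K N m p0 pm] by (auto simp: weights_def)
  then have "?S \<noteq> {}" by blast
  moreover have "continuous_on ?S (\<lambda>w. \<Sum>t\<in>?T. w t * ?cf t)"
    by (intro continuous_on_sum continuous_on_mult_right continuous_on_subset[OF continuous_on_product_coordinates]) auto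
  ultimately obtain w where w: "w \<in> ?S" and
    min: "\<And>v. v \<in> ?S \<Longrightarrow> (\<Sum>t\<in>?T. w t * ?cf t) \<le> (\<Sum>t\<in>?T. v t * ?cf t)"
    using continuous_attains_inf[of ?S "\<lambda>w. \<Sum>t\<in>?T. w t * ?cf t"] by auto
  have wW: "w \<in> weights N K p" using w by auto
  have "conflicts N E x = {}" if x: "x \<in> ?T" "0 < w x" for x
  proof (rule ccontr)
    assume "conflicts N E x \<noteq> {}"
    then obtain i j where ij: "i < N" "j < N" "i \<noteq> j" "E (x i) (x j)"
      by (auto simp: conflicts_def)
    let ?J = "{..<N} - {i}"
    \<comment> \<open>Exchange the \<open>i\<close>-th entries of \<open>x\<close> and
      \<open>t\<close>. Tuples in \<open>?A j\<close> put into \<open>x\<close> an entry that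
      conflicts with \<open>x j\<close>; those in \<open>?B j\<close> receive the entry
      \<open>x i\<close>, which conflicts with \<open>t j\<close>. These are 2 (N - 1) sets of mass
      at most \<open>\<kappa> * m\<close>, so \<open>small\<close> leaves a tuple of positive weight
      outside all of them.\<close>
    let ?A = "\<lambda>j. {t \<in> ?T. E (x j) (t i)}" and ?B = "\<lambda>j. {t \<in> ?T. E (x i) (t j)}"
    let ?bad = "\<Union>j\<in>?J. ?A j \<union> ?B j"
    have xK: "x j \<in> K" if "j < N" for j using x that by (auto simp: PiE_iff)
    have S1: "(\<Sum>t\<in>{t \<in> ?T. E (x k) (t l)}. w t) \<le> \<kappa> * m" if "k < N" "l < N" for k l
    proof -
      have "{t \<in> ?T. E (x k) (t l)} = {t. t \<in> ?T \<and> t l \<in> {b \<in> K. E (x k) b}}"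
        using that by (auto simp: PiE_iff)
      then show ?thesis
        using weights_sum_subset[OF wW K that(2), of "{b \<in> K. E (x k) b}"] \<kappa>[OF that(2) xK[OF that(1)]]
        by simp
    qed
    have "(\<Sum>t\<in>?bad. w t) \<le> (\<Sum>j\<in>?J. \<Sum>t\<in>?A j \<union> ?B j. w t)"
      by (rule sum_UN_le) (use fT in \<open>auto intro: weights_nonneg[OF wW]\<close>)
    also have "\<dots> \<le> (\<Sum>j\<in>?J. 2 * \<kappa> * m)"
    proof (rule sum_mono)
      fix j assume j: "j \<in> ?J"
      have "(\<Sum>t\<in>?A j \<union> ?B j. w t) + (\<Sum>t\<in>?A j \<inter> ?B j. w t) = (\<Sum>t\<in>?A j. w t) + (\<Sum>t\<in>?B j. w t)"
        by (intro sum.union_inter) (use fT in auto)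
      moreover have "0 \<le> (\<Sum>t\<in>?A j \<inter> ?B j. w t)"
        by (intro sum_nonneg) (auto intro: weights_nonneg[OF wW])
      moreover have "(\<Sum>t\<in>?A j. w t) \<le> \<kappa> * m" "(\<Sum>t\<in>?B j. w t) \<le> \<kappa> * m"
        using S1 j ij by auto
      ultimately show "(\<Sum>t\<in>?A j \<union> ?B j. w t) \<le> 2 * \<kappa> * m" by linarith
    qed
    also have "\<dots> = (2 * (real N - 1) * \<kappa>) * m"
      using ij by (simp add: of_nat_diff)
    also have "\<dots> < 1 * m" using small m by (intro mult_strict_right_mono)
    also have "1 * m = (\<Sum>t\<in>?T. w t)" using weights_total[OF wW K ij(1)] pm[OF ij(1)] by simp
    finally have less: "(\<Sum>t\<in>?bad. w t) < (\<Sum>t\<in>?T. w t)" .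
    have "\<exists>y\<in>?T - ?bad. 0 < w y"
    proof (rule ccontr)
      assume "\<not> ?thesis"
      then have "w y = 0" if "y \<in> ?T - ?bad" for y
        using that weights_nonneg[OF wW, of y] by (meson DiffD1 order_antisym_conv not_less)
      then have "(\<Sum>t\<in>?bad. w t) = (\<Sum>t\<in>?T. w t)"
        by (intro sum.mono_neutral_left) (use fT in auto)
      with less show False by simp
    qed
    then obtain y where y: "y \<in> ?T" "0 < w y" and ybad: "y \<notin> ?bad"
      by auto
    have y1: "\<not> E (x j) (y i)" and y2: "\<not> E (x i) (y j)" if "j < N" "j \<noteq> i" for j
      using ybad y(1) that by auto
    have y1': "\<not> E (y i) (x j)" if "j < N" "j \<noteq> i" for j
      using y1[OF that] E[of "y i" "x j"] by blast
    have y2': "\<not> E (y j) (x i)" if "j < N" "j \<noteq> i" for j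
      using y2[OF that] E[of "y j" "x i"] by blast
    \<comment> \<open>\<open>x i\<close> conflicts with \<open>x j\<close> but not with
      \<open>y j\<close>. Were \<open>y = x\<close>, moving mass \<open>e\<close> would subtract
      \<open>2 * e\<close> from \<open>w x\<close>.\<close>
    have xy: "x \<noteq> y" using y2[of j] ij by metis
    define x' where "x' = x(i := y i)"
    define y' where "y' = y(i := x i)"
    have x': "x' \<in> ?T" and y': "y' \<in> ?T"
      using x y ij by (auto simp: x'_def y'_def PiE_iff extensional_def)
    define e where "e = min (w x) (w y)"
    have e: "0 < e" "e \<le> w x" "e \<le> w y" using x y by (auto simp: e_def)
    \<comment> \<open>Moves mass from \<open>x\<close> and \<open>y\<close> to the two exchanged
      tuples. As a signed sum it needs no case distinction on coincidences among the four.\<close>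
    define d :: "(nat \<Rightarrow> 'k) \<Rightarrow> real" where
      "d t = of_bool (t = x') + of_bool (t = y') - of_bool (t = x) - of_bool (t = y)" for t
    define v where "v t = w t + e * d t" for t
    have at: "(\<Sum>t\<in>?T. of_bool (t = z) * g t) = g z" if "z \<in> ?T" for z and g :: "_ \<Rightarrow> real"
    proof -
      have "(\<Sum>t\<in>?T. of_bool (t = z) * g t) = (\<Sum>t\<in>?T. if t = z then g t else 0)"
        by (intro sum.cong) auto
      then show ?thesis using that fT by simp
    qed
    have d_sum: "(\<Sum>t\<in>?T. d t * g t) = g x' + g y' - g x - g y" for g
      by (simp only: d_def left_diff_distrib distrib_right sum.distrib sum_subtractf
          at[OF x(1)] at[OF y(1)] at[OF x'] at[OF y'])
    have "v \<in> ?S"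
    proof -
      have "0 \<le> v t" if "t \<in> ?T" for t
        using weights_nonneg[OF wW that] e xy by (auto simp: v_def d_def of_bool_def)
      moreover have "(\<Sum>t | t \<in> ?T \<and> t k = a. v t) = p k a" if "k < N" "a \<in> K" for k a
      proof -
        have "(\<Sum>t | t \<in> ?T \<and> t k = a. d t) = (\<Sum>t\<in>?T. d t * of_bool (t k = a))"
          by (intro sum.mono_neutral_cong_left) (use fT in auto)
        \<comment> \<open>In each coordinate \<open>x'\<close> and \<open>y'\<close> carry the same
          two values as \<open>x\<close> and \<open>y\<close>, possibly swapped.\<close>
        also have "\<dots> = 0" unfolding d_sum by (auto simp: x'_def y'_def)
        finally have "(\<Sum>t | t \<in> ?T \<and> t k = a. d t) = 0" .
        then show ?thesis
          using weights_marginal[OF wW that]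
          by (simp add: v_def sum.distrib sum_distrib_left[symmetric])
      qed
      moreover have "v t = 0" if "t \<notin> ?T" for t
        using that w x(1) y(1) x' y' by (auto simp: v_def d_def)
      ultimately show ?thesis by (auto simp: weights_def)
    qed
    from min[OF this] have "(\<Sum>t\<in>?T. w t * ?cf t) \<le> (\<Sum>t\<in>?T. w t * ?cf t + e * (d t * ?cf t))"
      by (simp add: v_def algebra_simps)
    also have "\<dots> = (\<Sum>t\<in>?T. w t * ?cf t) + e * (\<Sum>t\<in>?T. d t * ?cf t)"
      by (simp add: sum.distrib sum_distrib_left)
    finally have "0 \<le> (\<Sum>t\<in>?T. d t * ?cf t)" using e by (simp add: zero_le_mult_iff)
    then have ge: "?cf x + ?cf y \<le> ?cf x' + ?cf y'" unfolding d_sum by simp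
    have "conflicts N E x' \<subseteq> {(j, k) \<in> conflicts N E x. j \<noteq> i}"
      unfolding x'_def by (rule conflicts_upd_subset) (fact y1' y1)+
    moreover have "conflicts N E y' \<subseteq> {(j, k) \<in> conflicts N E y. j \<noteq> i}"
      unfolding y'_def by (rule conflicts_upd_subset) (fact y2 y2')+
    moreover have "(i, j) \<in> conflicts N E x"
      using ij by (simp add: conflicts_def)
    \<comment> \<open>\<open>x'\<close> loses the pair \<open>(i, j)\<close> and \<open>y'\<close>
      gains none, against the minimality recorded in \<open>ge\<close>.\<close>
    ultimately have "card (conflicts N E x') < card (conflicts N E x)"
      "card (conflicts N E y') \<le> card (conflicts N E y)"
      by (intro psubset_card_mono card_mono finite_conflicts; blast)+
    with ge show False by linarith
  qed
  with wW show ?thesis by blast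
qed

text \<open>The residue \<open>q - (1 - \<theta>) * P i\<close> has mass at least \<theta>, and on
  the neighbourhood of a cell it has at most \<theta> times the mass of \<open>q\<close> plus the
  errors \<epsilon> and \<epsilon>'. The condition on \<kappa> says that \<kappa> * \<theta> absorbs
  these errors, so the residue can be filled without conflicts. \<open>G\<close> singles out the
  tuples to keep; the comparison of \<open>p\<close> with \<open>q\<close> is asked only for cells
  that occur in them.\<close>

lemma transfer_weights:
  fixes p q :: "'k \<Rightarrow> real"
  assumes K: "finite K" and N: "N > 0"
    and w: "w \<in> weights N K (\<lambda>_. p)"
    and p1: "(\<Sum>a\<in>K. p a) = 1" and q1: "(\<Sum>a\<in>K. q a) = 1"
    and q0: "\<And>a. a \<in> K \<Longrightarrow> 0 \<le> q a"
    and \<theta>: "0 < \<theta>" "\<theta> \<le> 1"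
    and bad: "(\<Sum>t\<in>tuples N K - G. w t) \<le> \<epsilon>"
    and good: "\<And>t i. t \<in> tuples N K \<inter> G \<Longrightarrow> i < N \<Longrightarrow> (1 - \<theta>) * p (t i) \<le> q (t i)"
    and E: "\<And>a b. E a b \<Longrightarrow> E b a"
    and nbhd: "\<And>a. a \<in> K \<Longrightarrow> (\<Sum>b | b \<in> K \<and> E a b. q b) \<le> \<kappa>'"
    and diff: "\<And>a. a \<in> K \<Longrightarrow> (\<Sum>b | b \<in> K \<and> E a b. q b) \<le> (\<Sum>b | b \<in> K \<and> E a b. p b) + \<epsilon>'"
    and \<epsilon>': "0 \<le> \<epsilon>'"
    and \<kappa>: "0 \<le> \<kappa>" "\<theta> * \<kappa>' + \<epsilon>' + \<epsilon> \<le> \<kappa> * \<theta>" "2 * (real N - 1) * \<kappa> < 1"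
  shows "\<exists>v. (\<lambda>t. (1 - \<theta>) * (if t \<in> G then w t else 0) + v t) \<in> weights N K (\<lambda>_. q) \<and>
    (\<forall>t\<in>tuples N K. 0 \<le> v t) \<and> (\<Sum>t\<in>tuples N K. v t) \<le> \<theta> + \<epsilon> \<and>
    (\<forall>t\<in>tuples N K. 0 < v t \<longrightarrow> conflicts N E t = {})"
proof -
  let ?T = "tuples N K"
  have fT: "finite ?T" using K by (rule finite_tuples)
  have w0: "0 \<le> w t" if "t \<in> ?T" for t using weights_nonneg[OF w that] .
  define u where "u t = (if t \<in> G then w t else 0)" for t
  define P where "P i a = (\<Sum>t | t \<in> ?T \<and> t i = a. u t)" for i a
  define r where "r i a = q a - (1 - \<theta>) * P i a" for i a
  define m where "m = 1 - (1 - \<theta>) * (\<Sum>t\<in>?T. u t)"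
  have u0: "0 \<le> u t" and uw: "u t \<le> w t" if "t \<in> ?T" for t
    using w0[OF that] by (auto simp: u_def)
  have u: "u \<in> weights N K P"
    using u0 by (simp add: weights_def P_def)
  have P_le: "P i a \<le> p a" if "i < N" "a \<in> K" for i a
  proof -
    have "P i a \<le> (\<Sum>t | t \<in> ?T \<and> t i = a. w t)"
      unfolding P_def by (intro sum_mono) (use uw in auto)
    then show ?thesis using weights_marginal[OF w that] by simp
  qed
  \<comment> \<open>A cell that is never the \<open>i\<close>-th entry of a tuple in
    \<open>G\<close> has \<open>P i a = 0\<close>, so its residue is \<open>q a\<close>; otherwise
    \<open>good\<close> applies.\<close>
  have r0: "0 \<le> r i a" if "i < N" "a \<in> K" for i a
  proof (cases "\<exists>t\<in>?T \<inter> G. t i = a")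
    case True
    then obtain t where t: "t \<in> ?T \<inter> G" "t i = a" by blast
    have "(1 - \<theta>) * P i a \<le> (1 - \<theta>) * p a"
      using P_le[OF that] \<theta> by (intro mult_left_mono) auto
    also have "\<dots> \<le> q a" using good[OF t(1) that(1)] t(2) by simp
    finally show ?thesis by (simp add: r_def)
  next
    case False
    then have "P i a = 0"
      unfolding P_def by (intro sum.neutral) (auto simp: u_def)
    then show ?thesis using q0[OF that(2)] by (simp add: r_def)
  qed
  have sum_w: "(\<Sum>t\<in>?T. w t) = 1"
    using weights_total[OF w K N] p1 by simp
  have sum_u_le: "(\<Sum>t\<in>?T. u t) \<le> 1"
    unfolding sum_w[symmetric] by (intro sum_mono uw)
  have defect: "(\<Sum>t\<in>S. w t) - (\<Sum>t\<in>S. u t) \<le> \<epsilon>" if "S \<subseteq> ?T" for S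
  proof -
    have "(\<Sum>t\<in>S. w t) - (\<Sum>t\<in>S. u t) \<le> (\<Sum>t\<in>?T. w t - u t)"
      unfolding sum_subtractf[symmetric]
      by (intro sum_mono2 fT that) (use uw in auto)
    also have "\<dots> = (\<Sum>t\<in>?T - G. w t)"
      by (intro sum.mono_neutral_cong_right) (use fT in \<open>auto simp: u_def\<close>)
    finally show ?thesis using bad by simp
  qed
  have \<epsilon>: "0 \<le> \<epsilon>" using defect[of "{}"] by simp
  have "(1 - \<theta>) * (\<Sum>t\<in>?T. u t) \<le> (1 - \<theta>) * 1"
    using sum_u_le \<theta> by (intro mult_left_mono) auto
  then have m_ge: "\<theta> \<le> m" by (simp add: m_def)
  have "(1 - \<theta>) * (1 - \<epsilon>) \<le> (1 - \<theta>) * (\<Sum>t\<in>?T. u t)"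
    using defect[of ?T] sum_w \<theta> by (intro mult_left_mono) auto
  moreover have "0 \<le> \<theta> * \<epsilon>" using \<theta> \<epsilon> by simp
  ultimately have m_le: "m \<le> \<theta> + \<epsilon>" by (simp add: m_def algebra_simps)
  have r_sum: "(\<Sum>a\<in>K. r i a) = m" if "i < N" for i
    using weights_total[OF u K that] q1
    by (simp add: r_def m_def sum_subtractf sum_distrib_left)
  \<comment> \<open>Here the share \<theta> of \<open>q\<close> in the residue pays off: the
    neighbourhood is bounded by \<open>\<kappa> * \<theta>\<close>, hence by \<kappa> times the true
    mass \<open>m\<close>.\<close>
  have r_nbhd: "(\<Sum>b | b \<in> K \<and> E a b. r i b) \<le> \<kappa> * m" if i: "i < N" and a: "a \<in> K" for i a
  proof -
    let ?B = "{b. b \<in> K \<and> E a b}"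
    have B: "?B \<subseteq> K" by auto
    have "(\<Sum>b\<in>?B. p b) - (\<Sum>b\<in>?B. P i b) \<le> \<epsilon>"
      using weights_sum_subset[OF w K i B] weights_sum_subset[OF u K i B]
        defect[of "{t. t \<in> ?T \<and> t i \<in> ?B}"] by auto
    with diff[OF a] have "(\<Sum>b\<in>?B. q b) - (\<epsilon> + \<epsilon>') \<le> (\<Sum>b\<in>?B. P i b)" by linarith
    then have "(1 - \<theta>) * ((\<Sum>b\<in>?B. q b) - (\<epsilon> + \<epsilon>')) \<le> (1 - \<theta>) * (\<Sum>b\<in>?B. P i b)"
      using \<theta> by (intro mult_left_mono) auto
    moreover have "(\<Sum>b\<in>?B. r i b) = (\<Sum>b\<in>?B. q b) - (1 - \<theta>) * (\<Sum>b\<in>?B. P i b)"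
      by (simp only: r_def sum_subtractf sum_distrib_left)
    ultimately have "(\<Sum>b\<in>?B. r i b) \<le> \<theta> * (\<Sum>b\<in>?B. q b) + (1 - \<theta>) * (\<epsilon> + \<epsilon>')"
      by (simp add: algebra_simps)
    also have "\<dots> \<le> \<theta> * \<kappa>' + 1 * (\<epsilon> + \<epsilon>')"
      using \<theta> \<epsilon> \<epsilon>' nbhd[OF a] by (intro add_mono mult_left_mono mult_right_mono) auto
    also have "\<dots> \<le> \<kappa> * \<theta>" using \<kappa>(2) by simp
    also have "\<dots> \<le> \<kappa> * m" using m_ge \<kappa>(1) by (intro mult_left_mono)
    finally show ?thesis .
  qed
  have "0 < m" using m_ge \<theta> by linarith
  then have "\<exists>v\<in>weights N K r. \<forall>t\<in>?T. 0 < v t \<longrightarrow> conflicts N E t = {}"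
    using K N r0 r_sum E r_nbhd \<kappa>(3)
    by (intro conflict_free_weights[where m = m and \<kappa> = \<kappa>])
  then obtain v where v: "v \<in> weights N K r"
    and free: "\<forall>t\<in>?T. 0 < v t \<longrightarrow> conflicts N E t = {}"
    by blast
  have "(\<lambda>t. (1 - \<theta>) * u t) \<in> weights N K (\<lambda>i a. (1 - \<theta>) * P i a)"
    using u \<theta> by (auto simp: weights_def sum_distrib_left[symmetric])
  from weights_add[OF this v]
  have "(\<lambda>t. (1 - \<theta>) * u t + v t) \<in> weights N K (\<lambda>_. q)"
    by (simp add: r_def)
  moreover have "(\<Sum>t\<in>?T. v t) \<le> \<theta> + \<epsilon>"
    using weights_total[OF v K N] r_sum[OF N] m_le by simp
  moreover have "\<forall>t\<in>?T. 0 \<le> v t" using v by (auto intro: weights_nonneg)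
  ultimately show ?thesis
    using free unfolding u_def by (intro exI[of _ v] conjI)
qed

subsection \<open>Plans and weights\<close>

lemma borel_probsD:
  assumes "\<rho> \<in> borel_probs"
  shows "prob_space \<rho>" "sets \<rho> = sets borel" "space \<rho> = UNIV"
  using assms sets_eq_imp_space_eq[of \<rho> borel] by (auto simp: space_prob_algebra)

text \<open>Cells are functions rather than sets: the mass of a continuous cell passes to narrow
  limits, whereas for sets this may fail if the boundary has mass.\<close>

locale partition_of_unity =
  fixes K :: "'k set" and \<psi> :: "'k \<Rightarrow> 'a::euclidean_space \<Rightarrow> real"
  assumes finite_K: "finite K"
    and \<psi>_measurable: "\<And>a. \<psi> a \<in> borel_measurable borel"
    and \<psi>_nonneg: "\<And>a x. 0 \<le> \<psi> a x"
    and \<psi>_sum: "\<And>x. (\<Sum>a\<in>K. \<psi> a x) = 1"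
begin

definition cell_mass :: "'a measure \<Rightarrow> 'k \<Rightarrow> real" where
  "cell_mass \<rho> a = (\<integral>x. \<psi> a x \<partial>\<rho>)"

definition plan_weight :: "nat \<Rightarrow> (nat \<Rightarrow> 'a) measure \<Rightarrow> (nat \<Rightarrow> 'k) \<Rightarrow> real" where
  "plan_weight N P t = (\<integral>x. (\<Prod>i<N. \<psi> (t i) (x i)) \<partial>P)"

lemma \<psi>_le_1: "a \<in> K \<Longrightarrow> \<psi> a x \<le> 1"
  using member_le_sum[of a K "\<lambda>a. \<psi> a x"] \<psi>_nonneg \<psi>_sum[of x] finite_K by auto

lemma \<psi>_integrable:
  assumes "\<rho> \<in> borel_probs" "a \<in> K"
  shows "integrable \<rho> (\<psi> a)"
proof -
  interpret prob_space \<rho> using borel_probsD assms by auto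
  have "\<psi> a \<in> borel_measurable \<rho>"
    unfolding measurable_cong_sets[OF borel_probsD(2)[OF assms(1)] refl] by (rule \<psi>_measurable)
  then show ?thesis
    by (intro integrable_const_bound[where B = 1]) (use assms(2) \<psi>_nonneg \<psi>_le_1 in auto)
qed

lemma cell_mass_nonneg: "0 \<le> cell_mass \<rho> a"
  unfolding cell_mass_def by (intro integral_nonneg_AE) (simp add: \<psi>_nonneg)

lemma nn_integral_\<psi>:
  assumes "\<rho> \<in> borel_probs" "a \<in> K"
  shows "(\<integral>\<^sup>+x. ennreal (\<psi> a x) \<partial>\<rho>) = ennreal (cell_mass \<rho> a)"
  unfolding cell_mass_def
  by (intro nn_integral_eq_integral \<psi>_integrable assms) (simp add: \<psi>_nonneg)

lemma sum_cell_mass: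
  assumes "\<rho> \<in> borel_probs"
  shows "(\<Sum>a\<in>K. cell_mass \<rho> a) = 1"
proof -
  interpret prob_space \<rho> using borel_probsD assms by auto
  have "(\<Sum>a\<in>K. cell_mass \<rho> a) = (\<integral>x. (\<Sum>a\<in>K. \<psi> a x) \<partial>\<rho>)"
    unfolding cell_mass_def
    by (rule Bochner_Integration.integral_sum[symmetric]) (rule \<psi>_integrable[OF assms])
  then show ?thesis by (simp add: \<psi>_sum prob_space)
qed

text \<open>The functions of \<open>B\<close> add up to at most 1 and vanish off \<open>A\<close>,
  so their sum is below the indicator of \<open>A\<close>.\<close>

lemma sum_cell_mass_le_measure:
  assumes "\<rho> \<in> borel_probs" "B \<subseteq> K" "A \<in> sets borel"
    and "\<And>a x. a \<in> B \<Longrightarrow> 0 < \<psi> a x \<Longrightarrow> x \<in> A"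
  shows "(\<Sum>a\<in>B. cell_mass \<rho> a) \<le> measure \<rho> A"
proof -
  interpret prob_space \<rho> using borel_probsD assms by auto
  have A: "A \<in> sets \<rho>" using assms(3) borel_probsD(2)[OF assms(1)] by simp
  have "(\<Sum>a\<in>B. cell_mass \<rho> a) = (\<integral>x. (\<Sum>a\<in>B. \<psi> a x) \<partial>\<rho>)"
    unfolding cell_mass_def
    by (rule Bochner_Integration.integral_sum[symmetric]) (use \<psi>_integrable[OF assms(1)] assms(2) in blast)
  also have "\<dots> \<le> (\<integral>x. indicator A x \<partial>\<rho>)"
  proof (rule integral_mono)
    show "integrable \<rho> (\<lambda>x. \<Sum>a\<in>B. \<psi> a x)"
      using assms(2) by (intro Bochner_Integration.integrable_sum \<psi>_integrable[OF assms(1)]) auto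
    show "integrable \<rho> (indicator A :: _ \<Rightarrow> real)"
      by (intro integrable_real_indicator A) (simp add: less_top[symmetric])
    show "(\<Sum>a\<in>B. \<psi> a x) \<le> indicator A x" for x
    proof (cases "x \<in> A")
      case True
      have "(\<Sum>a\<in>B. \<psi> a x) \<le> (\<Sum>a\<in>K. \<psi> a x)"
        by (intro sum_mono2 finite_K assms(2) \<psi>_nonneg)
      then show ?thesis using True by (simp add: \<psi>_sum)
    next
      case False
      then have "\<psi> a x = 0" if "a \<in> B" for a
        using assms(4)[OF that, of x] \<psi>_nonneg[of a x] by force
      then show ?thesis by simp
    qed
  qed
  finally show ?thesis using A by simp
qed

text \<open>With respect to the product measure, the plan has as density the sum over
  \<open>t\<close> of \<open>w t\<close> times the product of the normalised cells \<psi> (t i) (x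
  i) / cell_mass \<rho> (t i). Integrating out all coordinates but one leaves the normalised cells
  weighted by the cell masses, which is \<rho> again. Each summand lives where
  \<open>f x \<le> g t\<close>, hence the cost bound.\<close>

lemma plan_of_weights:
  assumes \<rho>: "\<rho> \<in> borel_probs" and N: "N > 0"
    and w: "w \<in> weights N K (\<lambda>_. cell_mass \<rho>)"
    and f: "f \<in> borel_measurable (\<Pi>\<^sub>M i\<in>{..<N}. borel)"
    and le: "\<And>t x. t \<in> tuples N K \<Longrightarrow> 0 < w t \<Longrightarrow> (\<And>i. i < N \<Longrightarrow> 0 < \<psi> (t i) (x i)) \<Longrightarrow> f x \<le> g t"
  shows "\<exists>P\<in>transport_plans N \<rho>. (\<integral>\<^sup>+x. f x \<partial>P) \<le> (\<Sum>t\<in>tuples N K. ennreal (w t) * g t)"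
proof -
  let ?T = "tuples N K"
  interpret prob_space \<rho> using borel_probsD \<rho> by auto
  interpret product_sigma_finite "\<lambda>_. \<rho>" ..
  have sets_\<rho>[measurable_cong]: "sets \<rho> = sets borel" using borel_probsD \<rho> by auto
  note \<psi>_measurable[measurable] f[measurable]
  define R where "R = (\<Pi>\<^sub>M i\<in>{..<N}. \<rho>)"
  have sets_R[measurable_cong]: "sets R = sets (\<Pi>\<^sub>M i\<in>{..<N}. borel)"
    unfolding R_def by (intro sets_PiM_cong refl sets_\<rho>)
  \<comment> \<open>For a null cell the division by 0 yields \<open>F a x = 0\<close>. Such a cell
    occurs in no tuple of positive weight, by \<open>mass_pos\<close>.\<close>
  define F where "F a x = ennreal (\<psi> a x / cell_mass \<rho> a)" for a x
  have F[measurable]: "F a \<in> borel_measurable borel" for a unfolding F_def by measurable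
  define D where "D t x = (\<Prod>i<N. F (t i) (x i))" for t x
  have D[measurable]: "D t \<in> borel_measurable (\<Pi>\<^sub>M i\<in>{..<N}. borel)" for t
    unfolding D_def by measurable
  define h where "h x = (\<Sum>t\<in>?T. ennreal (w t) * D t x)" for x
  have h[measurable]: "h \<in> borel_measurable (\<Pi>\<^sub>M i\<in>{..<N}. borel)"
    unfolding h_def by measurable
  define P where "P = density R h"
  have sets_P[measurable_cong]: "sets P = sets (\<Pi>\<^sub>M i\<in>{..<N}. borel)"
    unfolding P_def by (simp add: sets_R)
  have mass_pos: "0 < cell_mass \<rho> (t i)" if "t \<in> ?T" "0 < w t" "i < N" for t i
    using weights_le_marginal[OF w finite_K that(3,1)] that(2) by simp
  have F_int: "(\<integral>\<^sup>+x. F a x \<partial>\<rho>) = 1" if "a \<in> K" "0 < cell_mass \<rho> a" for a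
  proof -
    have "(\<integral>\<^sup>+x. F a x \<partial>\<rho>) = (\<integral>\<^sup>+x. ennreal (\<psi> a x) / ennreal (cell_mass \<rho> a) \<partial>\<rho>)"
      unfolding F_def using that \<psi>_nonneg by (intro nn_integral_cong) (simp add: divide_ennreal)
    also have "\<dots> = ennreal (cell_mass \<rho> a) / ennreal (cell_mass \<rho> a)"
      using nn_integral_\<psi>[OF \<rho> that(1)] by (simp add: nn_integral_divide)
    also have "\<dots> = 1" using that by (simp add: divide_ennreal)
    finally show ?thesis .
  qed
  have marginal: "emeasure (distr P borel (\<lambda>x. x i)) B = emeasure \<rho> B"
    if i: "i < N" and B: "B \<in> sets borel" for i B
  proof -
    note B[measurable]
    have proj: "(\<lambda>x. x i) \<in> measurable (\<Pi>\<^sub>M i\<in>{..<N}. borel) borel"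
      using i by (intro measurable_component_singleton) simp
    have [measurable]: "(\<lambda>x. indicator B (x i) :: ennreal) \<in> borel_measurable (\<Pi>\<^sub>M i\<in>{..<N}. borel)"
      by (rule measurable_compose[OF proj borel_measurable_indicator[OF B]])
    \<comment> \<open>The indicator of \<open>B\<close> is distributed over the factors, with 1
      except at \<open>i\<close>, so that Fubini applies to a product of one-variable
      functions.\<close>
    define G where "G j x = (if j = i then indicator B x else 1 :: ennreal)" for j and x :: 'a
    have G[measurable]: "G j \<in> borel_measurable borel" for j unfolding G_def by measurable
    have FG: "(\<lambda>x. F a x * G j x) \<in> borel_measurable \<rho>" for a j
      unfolding measurable_cong_sets[OF sets_\<rho> refl] by (intro borel_measurable_times_ennreal F G)
    have G_prod: "(\<Prod>j<N. G j (x j)) = indicator B (x i)" for x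
      using i by (simp add: G_def)
    define H where "H a = (\<integral>\<^sup>+x. F a x * indicator B x \<partial>\<rho>)" for a
    have D_int: "ennreal (w t) * (\<integral>\<^sup>+x. D t x * indicator B (x i) \<partial>R) = ennreal (w t) * H (t i)"
      if t: "t \<in> ?T" for t
    proof (cases "0 < w t")
      case True
      have "(\<integral>\<^sup>+x. D t x * indicator B (x i) \<partial>R)
          = (\<integral>\<^sup>+x. (\<Prod>j<N. F (t j) (x j) * G j (x j)) \<partial>R)"
        by (simp add: D_def G_prod[symmetric] prod.distrib)
      also have "\<dots> = (\<Prod>j<N. \<integral>\<^sup>+x. F (t j) x * G j x \<partial>\<rho>)"
        unfolding R_def by (intro product_nn_integral_prod[where f="\<lambda>j x. F (t j) x * G j x"] FG) simp
      also have "\<dots> = (\<Prod>j<N. if j = i then H (t i) else 1)"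
      proof (intro prod.cong refl)
        fix j assume "j \<in> {..<N}"
        then show "(\<integral>\<^sup>+x. F (t j) x * G j x \<partial>\<rho>) = (if j = i then H (t i) else 1)"
          using F_int[of "t j"] mass_pos[OF t True, of j] PiE_mem[OF t, of j]
          by (simp add: G_def H_def)
      qed
      also have "\<dots> = H (t i)" using i by simp
      finally show ?thesis by simp
    next
      case False
      then have "w t = 0" using weights_nonneg[OF w t] by simp
      then show ?thesis by simp
    qed
    have H_mass: "ennreal (cell_mass \<rho> a) * H a = (\<integral>\<^sup>+x. ennreal (\<psi> a x) * indicator B x \<partial>\<rho>)"
      if a: "a \<in> K" for a
    proof (cases "cell_mass \<rho> a = 0")
      case True
      then have "(\<integral>\<^sup>+x. ennreal (\<psi> a x) \<partial>\<rho>) = 0" using nn_integral_\<psi>[OF \<rho> a] by simp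
      moreover have "(\<integral>\<^sup>+x. ennreal (\<psi> a x) * indicator B x \<partial>\<rho>) \<le> (\<integral>\<^sup>+x. ennreal (\<psi> a x) \<partial>\<rho>)"
        by (intro nn_integral_mono) (simp add: indicator_def)
      ultimately show ?thesis using True by simp
    next
      case False
      then have pos: "0 < cell_mass \<rho> a" using cell_mass_nonneg[of \<rho> a] by simp
      have "ennreal (cell_mass \<rho> a) * H a
          = (\<integral>\<^sup>+x. ennreal (cell_mass \<rho> a) * (F a x * indicator B x) \<partial>\<rho>)"
        unfolding H_def
        by (rule nn_integral_cmult[symmetric], unfold measurable_cong_sets[OF sets_\<rho> refl])
          (intro borel_measurable_times_ennreal F borel_measurable_indicator B)
      also have "\<dots> = (\<integral>\<^sup>+x. ennreal (\<psi> a x) * indicator B x \<partial>\<rho>)"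
        unfolding F_def mult.assoc[symmetric] using pos \<psi>_nonneg[of a]
        by (intro nn_integral_cong) (simp add: ennreal_mult'[symmetric])
      finally show ?thesis .
    qed
    have "emeasure (distr P borel (\<lambda>x. x i)) B = (\<integral>\<^sup>+y. indicator B y \<partial>distr P borel (\<lambda>x. x i))"
      using B by (simp add: nn_integral_indicator)
    also have "\<dots> = (\<integral>\<^sup>+x. indicator B (x i) \<partial>P)"
      using proj B by (intro nn_integral_distr) (simp_all add: measurable_cong_sets[OF sets_P refl])
    also have "\<dots> = (\<integral>\<^sup>+x. h x * indicator B (x i) \<partial>R)"
      unfolding P_def by (rule nn_integral_density) measurable
    also have "\<dots> = (\<integral>\<^sup>+x. (\<Sum>t\<in>?T. ennreal (w t) * (D t x * indicator B (x i))) \<partial>R)"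
      by (simp add: h_def sum_distrib_right mult.assoc)
    also have "\<dots> = (\<Sum>t\<in>?T. \<integral>\<^sup>+x. ennreal (w t) * (D t x * indicator B (x i)) \<partial>R)"
      by (rule nn_integral_sum) measurable
    also have "\<dots> = (\<Sum>t\<in>?T. ennreal (w t) * (\<integral>\<^sup>+x. D t x * indicator B (x i) \<partial>R))"
      by (intro sum.cong refl nn_integral_cmult) measurable
    also have "\<dots> = (\<Sum>t\<in>?T. ennreal (w t) * H (t i))"
      by (intro sum.cong refl D_int)
    also have "\<dots> = (\<Sum>a\<in>K. (\<Sum>t | t \<in> ?T \<and> t i = a. ennreal (w t)) * H a)"
      by (rule sum_tuples_coordinate[OF finite_K i])
    also have "\<dots> = (\<Sum>a\<in>K. ennreal (cell_mass \<rho> a) * H a)"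
    proof (intro sum.cong refl)
      fix a assume a: "a \<in> K"
      have "(\<Sum>t | t \<in> ?T \<and> t i = a. ennreal (w t)) = ennreal (\<Sum>t | t \<in> ?T \<and> t i = a. w t)"
        by (rule sum_ennreal) (auto intro: weights_nonneg[OF w])
      then show "(\<Sum>t | t \<in> ?T \<and> t i = a. ennreal (w t)) * H a = ennreal (cell_mass \<rho> a) * H a"
        using weights_marginal[OF w i a] by simp
    qed
    also have "\<dots> = (\<Sum>a\<in>K. \<integral>\<^sup>+x. ennreal (\<psi> a x) * indicator B x \<partial>\<rho>)"
      by (intro sum.cong refl H_mass)
    also have "\<dots> = (\<integral>\<^sup>+x. (\<Sum>a\<in>K. ennreal (\<psi> a x) * indicator B x) \<partial>\<rho>)"
      by (rule nn_integral_sum[symmetric], unfold measurable_cong_sets[OF sets_\<rho> refl])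
        (intro borel_measurable_times_ennreal measurable_compose[OF \<psi>_measurable measurable_ennreal]
          borel_measurable_indicator B)
    also have "\<dots> = (\<integral>\<^sup>+x. indicator B x \<partial>\<rho>)"
      by (simp add: sum_distrib_right[symmetric] sum_ennreal \<psi>_nonneg \<psi>_sum)
    also have "\<dots> = emeasure \<rho> B" using B sets_\<rho> by simp
    finally show ?thesis .
  qed
  have distr: "distr P borel (\<lambda>x. x i) = \<rho>" if "i < N" for i
    by (rule measure_eqI) (use marginal that sets_\<rho> in auto)
  have "prob_space P"
  proof
    \<comment> \<open>\<open>N > 0\<close> supplies a marginal from which the total mass is read
      off.\<close>
    have "emeasure P (space P) = emeasure (distr P borel (\<lambda>x. x 0)) UNIV"
      by (subst emeasure_distr) (use N in auto)
    also have "\<dots> = 1" using distr[OF N] emeasure_space_1 borel_probsD(3)[OF \<rho>] by simp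
    finally show "emeasure P (space P) = 1" .
  qed
  then have "P \<in> transport_plans N \<rho>"
    using distr sets_P by (simp add: transport_plans_def space_prob_algebra)
  moreover have "(\<integral>\<^sup>+x. f x \<partial>P) \<le> (\<Sum>t\<in>?T. ennreal (w t) * g t)"
  proof -
    have "(\<integral>\<^sup>+x. f x \<partial>P) = (\<integral>\<^sup>+x. h x * f x \<partial>R)"
      unfolding P_def by (rule nn_integral_density) measurable
    also have "\<dots> \<le> (\<integral>\<^sup>+x. (\<Sum>t\<in>?T. ennreal (w t) * g t * D t x) \<partial>R)"
    proof (intro nn_integral_mono)
      fix x
      have "ennreal (w t) * D t x * f x \<le> ennreal (w t) * g t * D t x" if t: "t \<in> ?T" for t
      proof (cases "0 < w t \<and> (\<forall>i<N. 0 < \<psi> (t i) (x i))")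
        case True
        then have "f x \<le> g t" using le[OF t] by blast
        then have "ennreal (w t) * D t x * f x \<le> ennreal (w t) * D t x * g t"
          by (intro mult_left_mono) auto
        then show ?thesis by (simp add: ac_simps)
      next
        case False
        then have "w t = 0 \<or> (\<exists>i<N. \<psi> (t i) (x i) = 0)"
          using weights_nonneg[OF w t] \<psi>_nonneg by (metis less_eq_real_def)
        \<comment> \<open>A vanishing density settles the summand even if \<open>f x\<close> is
          infinite, as 0 times \<infinity> is 0.\<close>
        then have "ennreal (w t) * D t x = 0"
          by (auto simp: D_def F_def) (metis div_0 ennreal_0 lessThan_iff)
        then show ?thesis by auto
      qed
      then show "h x * f x \<le> (\<Sum>t\<in>?T. ennreal (w t) * g t * D t x)"
        unfolding h_def sum_distrib_right by (intro sum_mono)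
    qed
    also have "\<dots> = (\<Sum>t\<in>?T. \<integral>\<^sup>+x. ennreal (w t) * g t * D t x \<partial>R)"
      by (rule nn_integral_sum) measurable
    also have "\<dots> = (\<Sum>t\<in>?T. ennreal (w t) * g t * (\<integral>\<^sup>+x. D t x \<partial>R))"
      by (intro sum.cong refl nn_integral_cmult) measurable
    also have "\<dots> = (\<Sum>t\<in>?T. ennreal (w t) * g t)"
    proof (intro sum.cong refl)
      fix t assume t: "t \<in> ?T"
      show "ennreal (w t) * g t * (\<integral>\<^sup>+x. D t x \<partial>R) = ennreal (w t) * g t"
      proof (cases "0 < w t")
        case True
        have "(\<integral>\<^sup>+x. D t x \<partial>R) = (\<Prod>j<N. \<integral>\<^sup>+x. F (t j) x \<partial>\<rho>)"
          unfolding R_def D_def by (intro product_nn_integral_prod) (simp_all add: measurable_cong_sets[OF sets_\<rho> refl] F)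
        also have "\<dots> = 1"
          using F_int mass_pos[OF t True] PiE_mem[OF t] by (intro prod.neutral) auto
        finally show ?thesis by simp
      next
        case False
        then have "w t = 0" using weights_nonneg[OF w t] by simp
        then show ?thesis by simp
      qed
    qed
    finally show ?thesis .
  qed
  ultimately show ?thesis by blast
qed

text \<open>The products \<open>D t\<close> form a partition of unity on configurations. Summing
  those with \<open>t i = a\<close> leaves \<psi> a (x i), so the marginals are the cell masses. The
  same decomposition, with \<open>f\<close> bounded below by \<open>g t\<close> wherever
  \<open>D t\<close> is positive, gives the inequality.\<close>

lemma
  assumes \<rho>: "\<rho> \<in> borel_probs" and P: "P \<in> transport_plans N \<rho>"
  shows plan_weight_in_weights: "plan_weight N P \<in> weights N K (\<lambda>_. cell_mass \<rho>)"
    and sum_plan_weight_le: "(\<And>t x. t \<in> tuples N K \<Longrightarrow> x \<in> space P \<Longrightarrow>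
      (\<And>i. i < N \<Longrightarrow> 0 < \<psi> (t i) (x i)) \<Longrightarrow> g t \<le> f x) \<Longrightarrow>
      (\<Sum>t\<in>tuples N K. ennreal (plan_weight N P t) * g t) \<le> (\<integral>\<^sup>+x. f x \<partial>P)"
proof -
  let ?T = "tuples N K"
  note \<psi>_measurable[measurable]
  have "prob_space P" and sets_P[measurable_cong]: "sets P = sets (\<Pi>\<^sub>M i\<in>{..<N}. borel)"
    and distr: "\<And>i. i < N \<Longrightarrow> distr P borel (\<lambda>x. x i) = \<rho>"
    using P by (auto simp: transport_plans_def space_prob_algebra)
  then interpret prob_space P by simp
  define D where "D t x = (\<Prod>i<N. \<psi> (t i) (x i))" for t x
  have D[measurable]: "D t \<in> borel_measurable P" for t
    unfolding D_def by measurable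
  have D0: "0 \<le> D t x" for t x
    unfolding D_def by (intro prod_nonneg) (simp add: \<psi>_nonneg)
  have D1: "D t x \<le> 1" if "t \<in> ?T" for t x
    unfolding D_def using that by (intro prod_le_1) (auto simp: \<psi>_nonneg intro!: \<psi>_le_1 PiE_mem[OF that])
  have D_int: "integrable P (D t)" if "t \<in> ?T" for t
    by (rule integrable_const_bound[where B = 1]) (use D0 D1[OF that] D in auto)
  have weight: "plan_weight N P t = (\<integral>x. D t x \<partial>P)" for t
    unfolding plan_weight_def D_def ..
  have D_sum: "(\<Sum>t\<in>?T. D t x) = 1" for x
    unfolding D_def by (subst prod_sum_PiE[symmetric]) (auto simp: finite_K \<psi>_sum)
  show "plan_weight N P \<in> weights N K (\<lambda>_. cell_mass \<rho>)"
  proof -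
    have "(\<Sum>t | t \<in> ?T \<and> t i = a. plan_weight N P t) = cell_mass \<rho> a" if i: "i < N" and a: "a \<in> K" for i a
    proof -
      have [measurable]: "(\<lambda>x. x i) \<in> measurable (\<Pi>\<^sub>M i\<in>{..<N}. borel) borel"
        using i by (intro measurable_component_singleton) simp
      have "(\<Sum>t | t \<in> ?T \<and> t i = a. plan_weight N P t) = (\<integral>x. (\<Sum>t | t \<in> ?T \<and> t i = a. D t x) \<partial>P)"
        unfolding weight by (rule Bochner_Integration.integral_sum[symmetric]) (auto intro: D_int)
      also have "\<dots> = (\<integral>x. \<psi> a (x i) \<partial>P)"
        unfolding D_def using sum_prod_tuples_fix[OF finite_K i a, of "\<lambda>j b. \<psi> b (x j)" for x]
        by (simp add: \<psi>_sum)
      also have "\<dots> = (\<integral>y. \<psi> a y \<partial>distr P borel (\<lambda>x. x i))"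
        by (rule integral_distr[symmetric]) measurable
      finally show ?thesis using distr[OF i] by (simp add: cell_mass_def)
    qed
    moreover have "0 \<le> plan_weight N P t" for t
      unfolding weight by (intro integral_nonneg_AE) (simp add: D0)
    ultimately show ?thesis by (simp add: weights_def)
  qed
  assume le: "\<And>t x. t \<in> ?T \<Longrightarrow> x \<in> space P \<Longrightarrow> (\<And>i. i < N \<Longrightarrow> 0 < \<psi> (t i) (x i)) \<Longrightarrow> g t \<le> f x"
  have "(\<Sum>t\<in>?T. ennreal (plan_weight N P t) * g t) = (\<Sum>t\<in>?T. \<integral>\<^sup>+x. ennreal (D t x) * g t \<partial>P)"
  proof (intro sum.cong refl)
    fix t assume t: "t \<in> ?T"
    have "ennreal (plan_weight N P t) = (\<integral>\<^sup>+x. ennreal (D t x) \<partial>P)"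
      unfolding weight by (intro nn_integral_eq_integral[symmetric] D_int t) (simp add: D0)
    then show "ennreal (plan_weight N P t) * g t = (\<integral>\<^sup>+x. ennreal (D t x) * g t \<partial>P)"
      by (simp add: nn_integral_multc)
  qed
  also have "\<dots> = (\<integral>\<^sup>+x. (\<Sum>t\<in>?T. ennreal (D t x) * g t) \<partial>P)"
    by (rule nn_integral_sum[symmetric]) measurable
  also have "\<dots> \<le> (\<integral>\<^sup>+x. f x \<partial>P)"
  proof (intro nn_integral_mono)
    fix x assume x: "x \<in> space P"
    have "ennreal (D t x) * g t \<le> ennreal (D t x) * f x" if t: "t \<in> ?T" for t
    proof (cases "\<forall>i<N. 0 < \<psi> (t i) (x i)")
      case True
      then show ?thesis using le[OF t x] by (intro mult_left_mono) auto
    next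
      case False
      then have "\<exists>i<N. \<psi> (t i) (x i) = 0"
        using \<psi>_nonneg by (metis less_eq_real_def)
      then have "D t x = 0" by (auto simp: D_def)
      then show ?thesis by simp
    qed
    then have "(\<Sum>t\<in>?T. ennreal (D t x) * g t) \<le> (\<Sum>t\<in>?T. ennreal (D t x)) * f x"
      unfolding sum_distrib_right by (intro sum_mono)
    also have "\<dots> = f x" by (simp add: sum_ennreal D0 D_sum)
    finally show "(\<Sum>t\<in>?T. ennreal (D t x) * g t) \<le> f x" .
  qed
  finally show "(\<Sum>t\<in>?T. ennreal (plan_weight N P t) * g t) \<le> (\<integral>\<^sup>+x. f x \<partial>P)" .
qed

end

subsection \<open>The cost function\<close>

lemma cost_measurable:
  fixes \<phi> :: "real \<Rightarrow> real"
  assumes "continuous_on {0<..} \<phi>"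
  shows "(cost \<phi> N :: (nat \<Rightarrow> 'a::euclidean_space) \<Rightarrow> _) \<in> borel_measurable (\<Pi>\<^sub>M i\<in>{..<N}. borel)"
proof -
  \<comment> \<open>\<phi> is arbitrary on the nonpositive reals, so it is cut off there.\<close>
  have [measurable]: "(\<lambda>t. indicator {0<..} t *\<^sub>R \<phi> t) \<in> borel_measurable borel"
    by (intro borel_measurable_continuous_on_indicator assms) auto
  have eq: "extended_potential \<phi> (norm z) =
      (if norm z = 0 then \<infinity> else ennreal (indicator {0<..} (norm z) *\<^sub>R \<phi> (norm z)))" for z :: 'a
    by (simp add: extended_potential_def)
  have "(\<lambda>x. extended_potential \<phi> (norm (x i - x j))) \<in> borel_measurable (\<Pi>\<^sub>M i\<in>{..<N}. borel :: 'a measure)"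
    if [simp]: "i < N" "j < N" for i j
    unfolding eq by measurable
  then show ?thesis
    unfolding cost_def[abs_def] by (intro borel_measurable_sum) auto
qed

lemma sum_triangle_le:
  fixes c :: ennreal
  shows "(\<Sum>j<N. \<Sum>i<j. c) \<le> of_nat (N\<^sup>2) * c"
proof -
  have "(\<Sum>j<N. \<Sum>i<j. c) \<le> (\<Sum>j<N. \<Sum>i<N. c)"
    by (intro sum_mono sum_mono2) auto
  then show ?thesis by (simp add: power2_eq_square mult.assoc)
qed

lemma cost_le:
  assumes "\<And>a. 0 < a \<Longrightarrow> 0 \<le> \<phi> a" "\<And>a b. 0 < a \<Longrightarrow> a \<le> b \<Longrightarrow> \<phi> b \<le> \<phi> a" "0 < r"
    and "\<And>i j. i < N \<Longrightarrow> j < N \<Longrightarrow> i \<noteq> j \<Longrightarrow> r \<le> norm (x i - x j)"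
  shows "cost \<phi> N x \<le> ennreal (real (N\<^sup>2) * \<phi> r)"
proof -
  have "cost \<phi> N x \<le> (\<Sum>j<N. \<Sum>i<j. ennreal (\<phi> r))"
    unfolding cost_def
  proof (intro sum_mono)
    fix i j assume "j \<in> {..<N}" "i \<in> {..<j}"
    then have "r \<le> norm (x i - x j)" by (intro assms(4)) auto
    then show "extended_potential \<phi> (norm (x i - x j)) \<le> ennreal (\<phi> r)"
      using assms(2)[of r "norm (x i - x j)"] assms(3)
      by (auto simp: extended_potential_def intro: ennreal_leI)
  qed
  also have "\<dots> \<le> of_nat (N\<^sup>2) * ennreal (\<phi> r)" by (rule sum_triangle_le)
  also have "\<dots> = ennreal (real (N\<^sup>2) * \<phi> r)"
    using assms(1,3) by (simp add: ennreal_mult' ennreal_of_nat_eq_real_of_nat)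
  finally show ?thesis .
qed

text \<open>One close pair already costs \<phi>(r), also when the two points coincide and the
  potential is infinite. This is the lower bound behind Markov's inequality.\<close>

lemma le_cost:
  assumes "\<And>a b. 0 < a \<Longrightarrow> a \<le> b \<Longrightarrow> \<phi> b \<le> \<phi> a"
    and "i < N" "j < N" "i \<noteq> j" "norm (x i - x j) < r"
  shows "ennreal (\<phi> r) \<le> cost \<phi> N x"
proof -
  have main: "ennreal (\<phi> r) \<le> cost \<phi> N x" if "i < j" "j < N" "norm (x i - x j) < r" for i j
  proof -
    have "ennreal (\<phi> r) \<le> extended_potential \<phi> (norm (x i - x j))"
      using assms(1)[of "norm (x i - x j)" r] that(3)
      by (auto simp: extended_potential_def intro: ennreal_leI)
    also have "\<dots> \<le> (\<Sum>i<j. extended_potential \<phi> (norm (x i - x j)))"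
      using that by (intro member_le_sum) auto
    also have "\<dots> \<le> cost \<phi> N x"
      unfolding cost_def using that by (intro member_le_sum[where f="\<lambda>j. \<Sum>i<j. extended_potential \<phi> (norm (x i - x j))"]) auto
    finally show ?thesis .
  qed
  show ?thesis
    using main[of i j] main[of j i] assms(2-) by (cases "i < j") (auto simp: norm_minus_commute)
qed

text \<open>Lipschitz control of \<phi> is available only beyond \<eta>, so separation is asked of
  both configurations.\<close>

lemma cost_le_cost_add:
  assumes "\<And>a. 0 < a \<Longrightarrow> 0 \<le> \<phi> a" "0 < \<eta>" "0 \<le> L" "0 \<le> e"
    and lip: "\<And>a b. \<eta> \<le> a \<Longrightarrow> \<eta> \<le> b \<Longrightarrow> \<bar>\<phi> a - \<phi> b\<bar> \<le> L * \<bar>a - b\<bar>"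
    and x: "\<And>i j. i < N \<Longrightarrow> j < N \<Longrightarrow> i \<noteq> j \<Longrightarrow> \<eta> \<le> norm (x i - x j)"
    and y: "\<And>i j. i < N \<Longrightarrow> j < N \<Longrightarrow> i \<noteq> j \<Longrightarrow> \<eta> \<le> norm (y i - y j)"
    and xy: "\<And>i j. i < N \<Longrightarrow> j < N \<Longrightarrow> i \<noteq> j \<Longrightarrow> \<bar>norm (y i - y j) - norm (x i - x j)\<bar> \<le> e"
  shows "cost \<phi> N y \<le> cost \<phi> N x + ennreal (real (N\<^sup>2) * (L * e))"
proof -
  have "cost \<phi> N y \<le> (\<Sum>j<N. \<Sum>i<j. extended_potential \<phi> (norm (x i - x j)) + ennreal (L * e))"
    unfolding cost_def
  proof (intro sum_mono)
    fix i j assume "j \<in> {..<N}" "i \<in> {..<j}"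
    then have ij: "i < N" "j < N" "i \<noteq> j" by auto
    have "\<phi> (norm (y i - y j)) - \<phi> (norm (x i - x j)) \<le> L * \<bar>norm (y i - y j) - norm (x i - x j)\<bar>"
      using lip[OF y[OF ij] x[OF ij]] by linarith
    also have "\<dots> \<le> L * e" using xy[OF ij] assms(3) by (rule mult_left_mono)
    finally have "ennreal (\<phi> (norm (y i - y j))) \<le> ennreal (\<phi> (norm (x i - x j)) + L * e)"
      by (intro ennreal_leI) simp
    also have "\<dots> = ennreal (\<phi> (norm (x i - x j))) + ennreal (L * e)"
      using assms(1)[OF less_le_trans[OF assms(2) x[OF ij]]] assms(3,4) by (intro ennreal_plus) auto
    finally show "extended_potential \<phi> (norm (y i - y j))
        \<le> extended_potential \<phi> (norm (x i - x j)) + ennreal (L * e)"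
      using x[OF ij] y[OF ij] assms(2) by (auto simp: extended_potential_def)
  qed
  also have "\<dots> = cost \<phi> N x + (\<Sum>j<N. \<Sum>i<j. ennreal (L * e))"
    by (simp only: cost_def sum.distrib)
  also have "\<dots> \<le> cost \<phi> N x + of_nat (N\<^sup>2) * ennreal (L * e)"
    by (intro add_left_mono sum_triangle_le)
  also have "of_nat (N\<^sup>2) * ennreal (L * e) = ennreal (real (N\<^sup>2) * (L * e))"
    using assms(3,4) by (simp add: ennreal_mult' ennreal_of_nat_eq_real_of_nat)
  finally show ?thesis .
qed

lemma lipschitz_away_from_zero:
  fixes \<phi> :: "real \<Rightarrow> real"
  assumes "\<phi> C1_differentiable_on {0<..}" "\<forall>t>0. \<exists>k. \<forall>s>t. \<bar>deriv \<phi> s\<bar> < k" "0 < \<eta>"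
  obtains L where "0 < L" "\<And>a b. \<eta> \<le> a \<Longrightarrow> \<eta> \<le> b \<Longrightarrow> \<bar>\<phi> a - \<phi> b\<bar> \<le> L * \<bar>a - b\<bar>"
proof -
  \<comment> \<open>The hypothesis bounds the derivative on open half-lines; starting at
    \<open>\<eta> / 2\<close> includes the endpoint \<eta>.\<close>
  obtain L where L: "\<And>s. s > \<eta> / 2 \<Longrightarrow> \<bar>deriv \<phi> s\<bar> < L"
    using assms(2,3) by (metis half_gt_zero)
  have der: "(\<phi> has_real_derivative deriv \<phi> s) (at s)" if "0 < s" for s
    using assms(1) that unfolding C1_differentiable_on_def
    by (metis DERIV_imp_deriv greaterThan_iff has_real_derivative_iff_has_vector_derivative)
  have "\<bar>\<phi> a - \<phi> b\<bar> \<le> L * \<bar>a - b\<bar>" if "\<eta> \<le> a" "\<eta> \<le> b" for a b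
  proof -
    have "norm (\<phi> a - \<phi> b) \<le> L * norm (a - b)"
    proof (rule field_differentiable_bound)
      show "convex {\<eta>..}" by simp
      show "(\<phi> has_field_derivative deriv \<phi> z) (at z within {\<eta>..})" if "z \<in> {\<eta>..}" for z
        using der[of z] that assms(3) by (auto intro: has_field_derivative_at_within)
      show "norm (deriv \<phi> z) \<le> L" if "z \<in> {\<eta>..}" for z
        using L[of z] that assms(3) by (auto simp: less_imp_le)
    qed (use that in auto)
    then show ?thesis by simp
  qed
  moreover have "0 < L" using L[of \<eta>] assms(3) by auto
  ultimately show ?thesis using that by blast
qed

subsection \<open>Comparison of optimal costs\<close>

lemma tail_measure_small:
  fixes \<rho> :: "'a::euclidean_space measure"
  assumes "\<rho> \<in> borel_probs" "0 < e"
  obtains R where "measure \<rho> {x. R < norm x} < e"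
proof -
  have sets: "sets \<rho> = sets borel" and "prob_space \<rho>"
    using assms by (auto simp: space_prob_algebra)
  then interpret prob_space \<rho> by simp
  let ?A = "\<lambda>n. {x :: 'a. real n < norm x}"
  have "(\<lambda>n. measure \<rho> (?A n)) \<longlonglongrightarrow> measure \<rho> (\<Inter>n. ?A n)"
    by (intro finite_Lim_measure_decseq) (auto simp: sets decseq_def intro!: borel_open open_Collect_less continuous_intros)
  moreover have "(\<Inter>n. ?A n) = {}"
  proof (intro equals0I)
    fix x assume x: "x \<in> (\<Inter>n. ?A n)"
    obtain n where "norm x \<le> real n" using real_arch_simple by blast
    moreover have "x \<in> ?A n" using x by (rule INT_D) simp
    ultimately show False by simp
  qed
  ultimately have "(\<lambda>n. measure \<rho> (?A n)) \<longlonglongrightarrow> 0" by simp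
  then have "\<forall>\<^sub>F n in sequentially. measure \<rho> (?A n) < e"
    using assms(2) by (rule order_tendstoD)
  then obtain n where "measure \<rho> (?A n) < e"
    unfolding eventually_sequentially by blast
  then show ?thesis by (rule that)
qed

text \<open>Tent functions on a finite cover of a closed ball, together with the excess of the norm
  over \<open>R\<close>, are divided by their sum. The sum is positive because a point outside the
  ball is seen by \<open>None\<close> and any other point by some centre.\<close>

lemma exists_partition_of_unity:
  fixes s R :: real
  assumes "0 < s"
  obtains K and \<psi> :: "'a option \<Rightarrow> 'a::euclidean_space \<Rightarrow> real"
  where "partition_of_unity K \<psi>" "\<And>a. continuous_on UNIV (\<psi> a)"
    "\<And>z x. 0 < \<psi> (Some z) x \<Longrightarrow> dist z x < s" "\<And>x. 0 < \<psi> None x \<Longrightarrow> R < norm x"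
proof -
  have "cball (0::'a) R \<subseteq> (\<Union>z\<in>cball 0 R. ball z s)" using assms by auto
  then obtain Z where Z: "finite Z" "cball (0::'a) R \<subseteq> (\<Union>z\<in>Z. ball z s)"
    by (rule compactE_image[OF compact_cball, rotated]) auto
  define K where "K = insert None (Some ` Z)"
  define b where "b a x = (case a of None \<Rightarrow> max 0 (norm x - R) | Some z \<Rightarrow> max 0 (s - dist z x))"
    for a :: "'a option" and x
  define \<psi> where "\<psi> a x = b a x / (\<Sum>a\<in>K. b a x)" for a x
  have K: "finite K" using Z by (simp add: K_def)
  have b0: "0 \<le> b a x" for a x by (simp add: b_def split: option.split)
  have pos: "0 < (\<Sum>a\<in>K. b a x)" for x
  proof -
    have "\<exists>a\<in>K. 0 < b a x"
    proof (cases "R < norm x")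
      case True
      then show ?thesis by (intro bexI[of _ None]) (simp_all add: b_def K_def)
    next
      case False
      then have "\<exists>z\<in>Z. dist z x < s" using Z(2) by (fastforce simp: subset_iff)
      then obtain z where "z \<in> Z" "dist z x < s" ..
      then show ?thesis by (intro bexI[of _ "Some z"]) (simp_all add: b_def K_def)
    qed
    then show ?thesis using K b0 by (metis sum_pos2)
  qed
  have b_cont: "continuous_on UNIV (b a)" for a
    unfolding b_def[abs_def] by (cases a) (auto intro!: continuous_intros)
  have cont: "continuous_on UNIV (\<psi> a)" for a
    unfolding \<psi>_def[abs_def] using pos
    by (intro continuous_on_divide continuous_on_sum b_cont) (auto simp: less_imp_neq[symmetric])
  have \<psi>_pos: "0 < b a x" if "0 < \<psi> a x" for a x
    using that pos[of x] by (simp add: \<psi>_def zero_less_divide_iff)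
  show ?thesis
  proof (rule that)
    show "partition_of_unity K \<psi>"
    proof
      show "\<psi> a \<in> borel_measurable borel" for a
        by (rule borel_measurable_continuous_onI[OF cont])
      show "(\<Sum>a\<in>K. \<psi> a x) = 1" for x
        using pos[of x] by (simp add: \<psi>_def sum_divide_distrib[symmetric])
      show "0 \<le> \<psi> a x" for a x using pos[of x] b0 by (simp add: \<psi>_def)
    qed (rule K)
    show "continuous_on UNIV (\<psi> a)" for a by (rule cont)
    show "dist z x < s" if "0 < \<psi> (Some z) x" for z x
      using \<psi>_pos[OF that] by (simp add: b_def)
    show "R < norm x" if "0 < \<psi> None x" for x
      using \<psi>_pos[OF that] by (simp add: b_def)
  qed
qed

section \<open>Upper bounds for optimal costs in terms of cells\<close>

context partition_of_unity
begin

text \<open>Defined through points rather than centres: if two cells are not close, all their points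
  are at distance at least \<open>r\<close>. A nonempty cell is close to itself for
  \<open>r > 0\<close>, so conflict-free tuples do not repeat it.\<close>

definition close_cells :: "real \<Rightarrow> 'k \<Rightarrow> 'k \<Rightarrow> bool" where
  "close_cells r a b \<longleftrightarrow> (\<exists>x y. 0 < \<psi> a x \<and> 0 < \<psi> b y \<and> norm (x - y) < r)"

definition cell_box :: "nat \<Rightarrow> (nat \<Rightarrow> 'k) \<Rightarrow> (nat \<Rightarrow> 'a) set" where
  "cell_box N t = {x. \<forall>i<N. 0 < \<psi> (t i) (x i)}"

lemma close_cells_sym: "close_cells r a b \<Longrightarrow> close_cells r b a"
  unfolding close_cells_def by (metis norm_minus_commute)

lemma separated_of_conflict_free:
  assumes "conflicts N (close_cells r) t = {}" "x \<in> cell_box N t" "i < N" "j < N" "i \<noteq> j"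
  shows "r \<le> norm (x i - x j)"
proof (rule ccontr)
  assume "\<not> r \<le> norm (x i - x j)"
  then have "close_cells r (t i) (t j)"
    using assms(2-4) unfolding close_cells_def cell_box_def
    by (intro exI[of _ "x i"] exI[of _ "x j"]) simp
  then have "(i, j) \<in> conflicts N (close_cells r) t"
    using assms by (simp add: conflicts_def)
  with assms(1) show False by simp
qed

lemma optimal_cost_le_of_weights:
  assumes "\<rho> \<in> borel_probs" "N > 0" "continuous_on {0<..} \<phi>"
    and "w \<in> weights N K (\<lambda>_. cell_mass \<rho>)"
  shows "optimal_cost \<phi> N \<rho> \<le> (\<Sum>t\<in>tuples N K. ennreal (w t) * (SUP x\<in>cell_box N t. cost \<phi> N x))"
proof -
  obtain P where "P \<in> transport_plans N \<rho>"
    "(\<integral>\<^sup>+x. cost \<phi> N x \<partial>P) \<le> (\<Sum>t\<in>tuples N K. ennreal (w t) * (SUP x\<in>cell_box N t. cost \<phi> N x))"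
    using plan_of_weights[OF assms(1,2,4) cost_measurable[OF assms(3)],
        of "\<lambda>t. SUP x\<in>cell_box N t. cost \<phi> N x"]
    by (auto simp: cell_box_def intro: SUP_upper)
  then show ?thesis unfolding optimal_cost_def by (meson INF_lower2)
qed

text \<open>Conflict-free weights of total mass 1 live on configurations with mutual distance at
  least \<open>r\<close>. The bound gives finiteness and allows plans of larger cost to be set
  aside.\<close>

lemma optimal_cost_bound:
  assumes \<rho>: "\<rho> \<in> borel_probs" and N: "N > 0" and cont: "continuous_on {0<..} \<phi>"
    and \<phi>: "\<And>a. 0 < a \<Longrightarrow> 0 \<le> \<phi> a" "\<And>a b. 0 < a \<Longrightarrow> a \<le> b \<Longrightarrow> \<phi> b \<le> \<phi> a"
    and r: "0 < r"
    and \<kappa>: "\<And>a. a \<in> K \<Longrightarrow> (\<Sum>b | b \<in> K \<and> close_cells r a b. cell_mass \<rho> b) \<le> \<kappa>"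
      "2 * (real N - 1) * \<kappa> < 1"
  shows "optimal_cost \<phi> N \<rho> \<le> ennreal (real (N\<^sup>2) * \<phi> r)"
proof -
  let ?M = "real (N\<^sup>2) * \<phi> r"
  have "\<exists>w\<in>weights N K (\<lambda>_. cell_mass \<rho>). \<forall>t\<in>tuples N K. 0 < w t \<longrightarrow> conflicts N (close_cells r) t = {}"
    by (rule conflict_free_weights[where m = 1 and \<kappa> = \<kappa>])
      (use N \<kappa> finite_K cell_mass_nonneg sum_cell_mass[OF \<rho>] close_cells_sym in auto)
  then obtain w where w: "w \<in> weights N K (\<lambda>_. cell_mass \<rho>)"
    and free: "\<And>t. t \<in> tuples N K \<Longrightarrow> 0 < w t \<Longrightarrow> conflicts N (close_cells r) t = {}"
    by blast
  have "optimal_cost \<phi> N \<rho> \<le> (\<Sum>t\<in>tuples N K. ennreal (w t) * (SUP x\<in>cell_box N t. cost \<phi> N x))"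
    by (rule optimal_cost_le_of_weights[OF \<rho> N cont w])
  also have "\<dots> \<le> (\<Sum>t\<in>tuples N K. ennreal (w t) * ennreal ?M)"
  proof (intro sum_mono)
    fix t assume t: "t \<in> tuples N K"
    show "ennreal (w t) * (SUP x\<in>cell_box N t. cost \<phi> N x) \<le> ennreal (w t) * ennreal ?M"
    proof (cases "0 < w t")
      case True
      have "(SUP x\<in>cell_box N t. cost \<phi> N x) \<le> ennreal ?M"
        by (intro SUP_least cost_le \<phi> r separated_of_conflict_free[OF free[OF t True]])
      then show ?thesis by (intro mult_left_mono) auto
    qed (simp add: ennreal_neg)
  qed
  also have "\<dots> = ennreal (\<Sum>t\<in>tuples N K. w t) * ennreal ?M"
    using weights_nonneg[OF w] by (simp add: sum_distrib_right[symmetric] sum_ennreal)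
  also have "\<dots> = ennreal ?M"
    using weights_total[OF w finite_K N] sum_cell_mass[OF \<rho>] by simp
  finally show ?thesis .
qed

text \<open>Beyond the cost of the plan there are two errors: the oscillation of the cost over the
  kept boxes, and the filling, of mass at most \<theta> + \<epsilon>. \<open>B\<close> collects
  cells exempt from the diameter bound and the mass comparison. A dropped tuple meets
  \<open>B\<close> in one of its N coordinates or has no separated point; this is the origin of
  \<open>real N * \<epsilon>\<^sub>1\<close> and \<open>\<epsilon>\<^sub>2\<close>.\<close>

lemma optimal_cost_le_plan_cost:
  fixes \<rho> \<rho>' :: "'a measure"
  assumes \<rho>: "\<rho> \<in> borel_probs" and \<rho>': "\<rho>' \<in> borel_probs" and N: "N > 0"
    and cont: "continuous_on {0<..} \<phi>"
    and \<phi>: "\<And>a. 0 < a \<Longrightarrow> 0 \<le> \<phi> a" "\<And>a b. 0 < a \<Longrightarrow> a \<le> b \<Longrightarrow> \<phi> b \<le> \<phi> a"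
    and r: "0 < r"
    and P: "P \<in> transport_plans N \<rho>"
    and cost_P: "(\<integral>\<^sup>+x. cost \<phi> N x \<partial>P) \<le> ennreal (\<phi> \<eta> * \<epsilon>\<^sub>2)"
    and \<eta>: "0 < \<eta>" "0 < \<phi> \<eta>" and \<epsilon>\<^sub>2: "0 \<le> \<epsilon>\<^sub>2"
    and L: "0 \<le> L" "\<And>a b. \<eta> / 2 \<le> a \<Longrightarrow> \<eta> / 2 \<le> b \<Longrightarrow> \<bar>\<phi> a - \<phi> b\<bar> \<le> L * \<bar>a - b\<bar>"
    and diam: "\<And>a x y. a \<in> K - B \<Longrightarrow> 0 < \<psi> a x \<Longrightarrow> 0 < \<psi> a y \<Longrightarrow> norm (x - y) \<le> d"
    and d: "0 \<le> d" "4 * d \<le> \<eta>"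
    and B: "B \<subseteq> K" "(\<Sum>a\<in>B. cell_mass \<rho> a) \<le> \<epsilon>\<^sub>1"
    and \<theta>: "0 < \<theta>" "\<theta> \<le> 1"
    and good: "\<And>a. a \<in> K - B \<Longrightarrow> (1 - \<theta>) * cell_mass \<rho> a \<le> cell_mass \<rho>' a"
    and \<epsilon>: "real N * \<epsilon>\<^sub>1 + \<epsilon>\<^sub>2 \<le> \<epsilon>"
    and nbhd: "\<And>a. a \<in> K \<Longrightarrow> (\<Sum>b | b \<in> K \<and> close_cells r a b. cell_mass \<rho>' b) \<le> \<kappa>'"
    and diff: "\<And>a. a \<in> K \<Longrightarrow> (\<Sum>b | b \<in> K \<and> close_cells r a b. cell_mass \<rho>' b)
        \<le> (\<Sum>b | b \<in> K \<and> close_cells r a b. cell_mass \<rho> b) + \<epsilon>'"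
    and \<epsilon>': "0 \<le> \<epsilon>'"
    and \<kappa>: "0 \<le> \<kappa>" "\<theta> * \<kappa>' + \<epsilon>' + \<epsilon> \<le> \<kappa> * \<theta>" "2 * (real N - 1) * \<kappa> < 1"
  shows "optimal_cost \<phi> N \<rho>' \<le> (\<integral>\<^sup>+x. cost \<phi> N x \<partial>P)
    + ennreal (real (N\<^sup>2) * (L * (2 * d))) + ennreal ((\<theta> + \<epsilon>) * (real (N\<^sup>2) * \<phi> r))"
proof -
  let ?T = "tuples N K"
  let ?M = "real (N\<^sup>2) * \<phi> r"
  let ?\<delta> = "real (N\<^sup>2) * (L * (2 * d))"
  have fT: "finite ?T" using finite_K by (rule finite_tuples)
  define w where "w = plan_weight N P"
  have w: "w \<in> weights N K (\<lambda>_. cell_mass \<rho>)"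
    unfolding w_def by (rule plan_weight_in_weights[OF \<rho> P])
  have w0: "0 \<le> w t" if "t \<in> ?T" for t using weights_nonneg[OF w that] .
  have sum_w: "(\<Sum>t\<in>?T. w t) = 1"
    using weights_total[OF w finite_K N] sum_cell_mass[OF \<rho>] by simp
  define sep where "sep x \<longleftrightarrow> (\<forall>i<N. \<forall>j<N. i \<noteq> j \<longrightarrow> \<eta> \<le> norm (x i - x j))" for x :: "nat \<Rightarrow> 'a"
  \<comment> \<open>In \<open>S\<close> no point of the box is separated, so the cost is at least
    \<phi>(\<eta>) on all of it and Markov's inequality bounds the weight. \<open>G\<close> asks for
    a single separated point; small diameters extend this to the whole box with
    \<open>\<eta> / 2\<close> in place of \<eta>.\<close>
  define S where "S = {t \<in> ?T. \<forall>x\<in>cell_box N t. \<not> sep x}"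
  define G where "G = {t. (\<forall>i<N. t i \<notin> B) \<and> (\<exists>x\<in>cell_box N t. sep x)}"
  have "(\<Sum>t\<in>S. w t) \<le> \<epsilon>\<^sub>2"
  proof -
    have "ennreal (\<phi> \<eta> * (\<Sum>t\<in>S. w t)) = ennreal (\<Sum>t\<in>?T. w t * (of_bool (t \<in> S) * \<phi> \<eta>))"
    proof -
      have "(\<Sum>t\<in>?T. w t * (of_bool (t \<in> S) * \<phi> \<eta>)) = (\<Sum>t\<in>S. \<phi> \<eta> * w t)"
        by (intro sum.mono_neutral_cong_right) (use fT in \<open>auto simp: S_def\<close>)
      then show ?thesis by (simp add: sum_distrib_left)
    qed
    also have "\<dots> = (\<Sum>t\<in>?T. ennreal (w t * (of_bool (t \<in> S) * \<phi> \<eta>)))"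
      using w0 \<eta> by (intro sum_ennreal[symmetric]) auto
    also have "\<dots> = (\<Sum>t\<in>?T. ennreal (w t) * ennreal (of_bool (t \<in> S) * \<phi> \<eta>))"
      using w0 \<eta> by (intro sum.cong refl ennreal_mult) auto
    also have "\<dots> \<le> (\<integral>\<^sup>+x. cost \<phi> N x \<partial>P)"
      unfolding w_def
    proof (rule sum_plan_weight_le[OF \<rho> P])
      fix t x assume "t \<in> ?T" and x: "\<And>i. i < N \<Longrightarrow> 0 < \<psi> (t i) (x i)"
      show "ennreal (of_bool (t \<in> S) * \<phi> \<eta>) \<le> cost \<phi> N x"
      proof (cases "t \<in> S")
        case True
        then have "\<not> sep x" using x by (auto simp: S_def cell_box_def)
        then obtain i j where "i < N" "j < N" "i \<noteq> j" "norm (x i - x j) < \<eta>"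
          by (auto simp: sep_def not_le)
        then have "ennreal (\<phi> \<eta>) \<le> cost \<phi> N x" by (intro le_cost[OF \<phi>(2)])
        then show ?thesis using True by simp
      qed simp
    qed
    also note cost_P
    finally have "\<phi> \<eta> * (\<Sum>t\<in>S. w t) \<le> \<phi> \<eta> * \<epsilon>\<^sub>2"
      using \<eta> \<epsilon>\<^sub>2 by (simp add: ennreal_le_iff)
    then show ?thesis using \<eta> by simp
  qed
  have bad: "(\<Sum>t\<in>?T - G. w t) \<le> \<epsilon>"
  proof -
    let ?U = "\<Union>i\<in>{..<N}. {t \<in> ?T. t i \<in> B}"
    have "(\<Sum>t\<in>?T - G. w t) \<le> (\<Sum>t\<in>?U \<union> S. w t)"
      by (intro sum_mono2) (use fT w0 in \<open>auto simp: S_def G_def\<close>)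
    also have "\<dots> \<le> (\<Sum>t\<in>?U. w t) + (\<Sum>t\<in>S. w t)"
    proof -
      have "(\<Sum>t\<in>?U \<union> S. w t) + (\<Sum>t\<in>?U \<inter> S. w t) = (\<Sum>t\<in>?U. w t) + (\<Sum>t\<in>S. w t)"
        by (intro sum.union_inter) (use fT in \<open>auto simp: S_def\<close>)
      moreover have "0 \<le> (\<Sum>t\<in>?U \<inter> S. w t)"
        by (intro sum_nonneg) (use w0 in auto)
      ultimately show ?thesis by linarith
    qed
    also have "(\<Sum>t\<in>?U. w t) \<le> (\<Sum>i<N. \<Sum>t | t \<in> ?T \<and> t i \<in> B. w t)"
      by (intro sum_UN_le) (use fT w0 in auto)
    also have "\<dots> \<le> (\<Sum>i<N. \<epsilon>\<^sub>1)"
      by (intro sum_mono) (use weights_sum_subset[OF w finite_K _ B(1)] B(2) in auto)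
    finally show ?thesis using \<open>(\<Sum>t\<in>S. w t) \<le> \<epsilon>\<^sub>2\<close> \<epsilon> by simp
  qed
  have "\<exists>v. (\<lambda>t. (1 - \<theta>) * (if t \<in> G then w t else 0) + v t) \<in> weights N K (\<lambda>_. cell_mass \<rho>') \<and>
    (\<forall>t\<in>?T. 0 \<le> v t) \<and> (\<Sum>t\<in>?T. v t) \<le> \<theta> + \<epsilon> \<and>
    (\<forall>t\<in>?T. 0 < v t \<longrightarrow> conflicts N (close_cells r) t = {})"
  proof (rule transfer_weights[OF finite_K N w sum_cell_mass[OF \<rho>] sum_cell_mass[OF \<rho>']
      cell_mass_nonneg \<theta> bad _ close_cells_sym nbhd diff \<epsilon>' \<kappa>])
    show "(1 - \<theta>) * cell_mass \<rho> (t i) \<le> cell_mass \<rho>' (t i)" if "t \<in> ?T \<inter> G" "i < N" for t i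
      using that by (intro good) (auto simp: G_def)
  qed
  then obtain v where
    wv: "(\<lambda>t. (1 - \<theta>) * (if t \<in> G then w t else 0) + v t) \<in> weights N K (\<lambda>_. cell_mass \<rho>')"
    and v0: "\<And>t. t \<in> ?T \<Longrightarrow> 0 \<le> v t" and v_sum: "(\<Sum>t\<in>?T. v t) \<le> \<theta> + \<epsilon>"
    and free: "\<And>t. t \<in> ?T \<Longrightarrow> 0 < v t \<Longrightarrow> conflicts N (close_cells r) t = {}"
    by blast
  define sup where "sup t = (SUP x\<in>cell_box N t. cost \<phi> N x)" for t
  \<comment> \<open>Off \<open>G\<close> the oscillation is not controlled; 0 is a lower bound for
    the cost in any case.\<close>
  define inf where "inf t = (if t \<in> G then INF x\<in>cell_box N t. cost \<phi> N x else 0)" for t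
  have sup_inf: "sup t \<le> inf t + ennreal ?\<delta>" if t: "t \<in> ?T" "t \<in> G" for t
  proof -
    obtain z where z: "z \<in> cell_box N t" "sep z" and tB: "\<And>i. i < N \<Longrightarrow> t i \<in> K - B"
      using t by (auto simp: G_def)
    have near: "\<bar>norm (y i - y j) - norm (x i - x j)\<bar> \<le> 2 * d"
      if "x \<in> cell_box N t" "y \<in> cell_box N t" "i < N" "j < N" for x y i j
    proof -
      have "norm (y i - x i) \<le> d" "norm (y j - x j) \<le> d"
        using that diam[OF tB[OF that(3)]] diam[OF tB[OF that(4)]] by (simp_all add: cell_box_def)
      moreover have "\<bar>norm (y i - y j) - norm (x i - x j)\<bar> \<le> norm ((y i - y j) - (x i - x j))"
        by (rule norm_triangle_ineq3)
      moreover have "norm ((y i - y j) - (x i - x j)) = norm ((y i - x i) - (y j - x j))"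
        by (simp add: algebra_simps)
      moreover have "\<dots> \<le> norm (y i - x i) + norm (y j - x j)"
        by (rule norm_triangle_ineq4)
      ultimately show ?thesis by linarith
    qed
    \<comment> \<open>Distances change by at most \<open>2 * d\<close> inside the box, and
      \<open>4 * d \<le> \<eta>\<close>.\<close>
    have far: "\<eta> / 2 \<le> norm (x i - x j)" if "x \<in> cell_box N t" "i < N" "j < N" "i \<noteq> j" for x i j
      using near[OF z(1) that(1-3)] z(2) that d by (fastforce simp: sep_def)
    have "cost \<phi> N y \<le> inf t + ennreal ?\<delta>" if y: "y \<in> cell_box N t" for y
    proof -
      have "cost \<phi> N y - ennreal ?\<delta> \<le> (INF x\<in>cell_box N t. cost \<phi> N x)"
      proof (intro INF_greatest)
        fix x assume x: "x \<in> cell_box N t"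
        have "cost \<phi> N y \<le> cost \<phi> N x + ennreal ?\<delta>"
          using \<eta> L d by (intro cost_le_cost_add[where \<eta> = "\<eta> / 2"] \<phi> far x y near) auto
        then show "cost \<phi> N y - ennreal ?\<delta> \<le> cost \<phi> N x"
          by (simp add: ennreal_minus_le_iff add.commute)
      qed
      then show ?thesis using t by (simp add: inf_def ennreal_minus_le_iff add.commute)
    qed
    then show ?thesis unfolding sup_def by (rule SUP_least)
  qed
  have "optimal_cost \<phi> N \<rho>' \<le>
      (\<Sum>t\<in>?T. ennreal ((1 - \<theta>) * (if t \<in> G then w t else 0) + v t) * sup t)"
    unfolding sup_def by (rule optimal_cost_le_of_weights[OF \<rho>' N cont wv])
  also have "\<dots> \<le> (\<Sum>t\<in>?T. (ennreal (w t) * inf t + ennreal (w t) * ennreal ?\<delta>) + ennreal (v t) * ennreal ?M)"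
  proof (intro sum_mono)
    fix t assume t: "t \<in> ?T"
    have 1: "ennreal ((1 - \<theta>) * (if t \<in> G then w t else 0)) * sup t \<le> ennreal (w t) * (inf t + ennreal ?\<delta>)"
    proof (cases "t \<in> G")
      case True
      have "(1 - \<theta>) * w t \<le> 1 * w t" using w0[OF t] \<theta> by (intro mult_right_mono) auto
      then show ?thesis using sup_inf[OF t True] True by (intro mult_mono ennreal_leI) auto
    qed simp
    have 2: "ennreal (v t) * sup t \<le> ennreal (v t) * ennreal ?M"
    proof (cases "0 < v t")
      case True
      have "sup t \<le> ennreal ?M" unfolding sup_def
        by (intro SUP_least cost_le \<phi> r separated_of_conflict_free[OF free[OF t True]])
      then show ?thesis by (intro mult_left_mono) auto
    qed (simp add: ennreal_neg)
    have "ennreal ((1 - \<theta>) * (if t \<in> G then w t else 0) + v t)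
        = ennreal ((1 - \<theta>) * (if t \<in> G then w t else 0)) + ennreal (v t)"
      using w0[OF t] v0[OF t] \<theta> by (intro ennreal_plus) auto
    then show "ennreal ((1 - \<theta>) * (if t \<in> G then w t else 0) + v t) * sup t
        \<le> (ennreal (w t) * inf t + ennreal (w t) * ennreal ?\<delta>) + ennreal (v t) * ennreal ?M"
      using add_mono[OF 1 2] by (simp add: distrib_left distrib_right)
  qed
  also have "\<dots> = (\<Sum>t\<in>?T. ennreal (w t) * inf t) + ennreal (\<Sum>t\<in>?T. w t) * ennreal ?\<delta>
      + ennreal (\<Sum>t\<in>?T. v t) * ennreal ?M"
    using w0 v0 by (simp add: sum.distrib sum_distrib_right[symmetric] sum_ennreal)
  also have "\<dots> \<le> (\<integral>\<^sup>+x. cost \<phi> N x \<partial>P) + ennreal ?\<delta> + ennreal ((\<theta> + \<epsilon>) * ?M)"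
  proof (intro add_mono)
    show "(\<Sum>t\<in>?T. ennreal (w t) * inf t) \<le> (\<integral>\<^sup>+x. cost \<phi> N x \<partial>P)"
      unfolding w_def by (rule sum_plan_weight_le[OF \<rho> P]) (auto simp: inf_def cell_box_def intro!: INF_lower)
    show "ennreal (\<Sum>t\<in>?T. w t) * ennreal ?\<delta> \<le> ennreal ?\<delta>" by (simp add: sum_w)
    have M: "0 \<le> ?M" using \<phi>(1)[OF r] by simp
    have "ennreal (\<Sum>t\<in>?T. v t) * ennreal ?M = ennreal ((\<Sum>t\<in>?T. v t) * ?M)"
      using v0 M by (simp add: ennreal_mult sum_nonneg)
    also have "\<dots> \<le> ennreal ((\<theta> + \<epsilon>) * ?M)"
      using v_sum M by (intro ennreal_leI mult_right_mono)
    finally show "ennreal (\<Sum>t\<in>?T. v t) * ennreal ?M \<le> ennreal ((\<theta> + \<epsilon>) * ?M)" .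
  qed
  finally show ?thesis .
qed

end

section \<open>Control of neighbourhoods of cells by the concentration\<close>

lemma le_concentration:
  fixes \<rho> :: "'a::euclidean_space measure"
  assumes "\<rho> \<in> borel_probs"
  shows "measure \<rho> (ball x r) \<le> concentration \<rho> r"
proof -
  interpret prob_space \<rho> using assms by (simp add: space_prob_algebra)
  show ?thesis
    unfolding concentration_def by (intro cSUP_upper bdd_aboveI[where M = 1]) auto
qed

text \<open>If \<open>a\<close> has centre \<open>u\<close>, a path from \<open>u\<close> to any
  point of a close cell \<open>Some z\<close> has length below
  \<open>s + r + s + s \<le> 4 * r\<close>. If \<open>a\<close> is the cell near infinity, such a
  point has lost at most \<open>r + 2 * s \<le> 3 * r\<close> of its norm. The bound does not
  involve \<open>s\<close>, so the cells may be refined after \<open>r\<close> is fixed.\<close>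

lemma close_cells_mass_le:
  fixes \<psi> :: "'a option \<Rightarrow> 'a::euclidean_space \<Rightarrow> real"
  assumes pou: "partition_of_unity K \<psi>"
    and Some: "\<And>z x. 0 < \<psi> (Some z) x \<Longrightarrow> dist z x < s"
    and None: "\<And>x. 0 < \<psi> None x \<Longrightarrow> R < norm x"
    and s: "0 < s" "s \<le> r" and \<rho>: "\<rho> \<in> borel_probs"
  shows "(\<Sum>b | b \<in> K \<and> partition_of_unity.close_cells \<psi> r a b. partition_of_unity.cell_mass \<psi> \<rho> b)
    \<le> concentration \<rho> (4 * r) + measure \<rho> {x. R - 3 * r < norm x}"
proof -
  interpret partition_of_unity K \<psi> by (rule pou)
  interpret prob_space \<rho> using \<rho> by (simp add: space_prob_algebra)
  have sets: "sets \<rho> = sets borel" using \<rho> by (simp add: space_prob_algebra)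
  \<comment> \<open>For \<open>a = None\<close> the centre 0 is a dummy: all points fall into the
    tail.\<close>
  define c where "c = (case a of None \<Rightarrow> 0 | Some z \<Rightarrow> z)"
  let ?A = "ball c (4 * r)" and ?T = "{x. R - 3 * r < norm x}"
  have T: "?T \<in> sets borel" by (intro borel_open open_Collect_less continuous_intros)
  have "(\<Sum>b | b \<in> K \<and> close_cells r a b. cell_mass \<rho> b) \<le> measure \<rho> (?A \<union> ?T)"
  proof (rule sum_cell_mass_le_measure[OF \<rho>])
    show "?A \<union> ?T \<in> sets borel" using T by simp
    fix b p assume b: "b \<in> {b \<in> K. close_cells r a b}" and p: "0 < \<psi> b p"
    then obtain x y where xy: "0 < \<psi> a x" "0 < \<psi> b y" "norm (x - y) < r"
      by (auto simp: close_cells_def)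
    then have d: "dist x y < r" by (simp add: dist_norm)
    show "p \<in> ?A \<union> ?T"
    proof (cases b)
      case None
      then show ?thesis using assms(3)[of p] p s by auto
    next
      case z: (Some z)
      have zp: "dist z p < s" and zy: "dist z y < s" using Some[of z] p xy z by auto
      show ?thesis
      proof (cases a)
        case None
        then have "R < norm x" using assms(3) xy by simp
        moreover have "norm x \<le> norm p + dist x p" by (metis dist_norm norm_triangle_sub)
        moreover have "dist x p \<le> dist x y + dist y z + dist z p"
          by (meson add_right_mono dist_triangle order_trans)
        ultimately show ?thesis using d zp zy s by (simp add: dist_commute)
      next
        case (Some u)
        then have "dist u x < s" using assms(2) xy by simp
        moreover have "dist u p \<le> dist u x + dist x y + dist y z + dist z p"
          by (meson add_right_mono dist_triangle order_trans)
        ultimately show ?thesis using d zp zy s Some by (simp add: dist_commute c_def)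
      qed
    qed
  qed auto
  also have "\<dots> \<le> measure \<rho> ?A + measure \<rho> ?T"
    using T sets by (intro measure_Un_le) auto
  also have "measure \<rho> ?A \<le> concentration \<rho> (4 * r)" by (rule le_concentration[OF \<rho>])
  finally show ?thesis by simp
qed

section \<open>Choice of constants and passage to the limit\<close>

lemma ennreal_tendstoI:
  fixes f :: "'b \<Rightarrow> ennreal"
  assumes c: "c < \<infinity>"
    and ev: "\<And>\<delta>. 0 < \<delta> \<Longrightarrow> \<forall>\<^sub>F n in F. f n \<le> c + ennreal \<delta> \<and> c \<le> f n + ennreal \<delta>"
  shows "(f \<longlongrightarrow> c) F"
proof (rule order_tendstoI)
  obtain c' where c': "c = ennreal c'" "0 \<le> c'" using c by (cases c) auto
  show "\<forall>\<^sub>F n in F. a < f n" if a: "a < c" for a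
  proof -
    obtain a' where a': "a = ennreal a'" "0 \<le> a'" using a by (cases a) auto
    then have "a' < c'" using a c' by (simp add: ennreal_less_iff)
    then have "\<forall>\<^sub>F n in F. c \<le> f n + ennreal ((c' - a') / 2)"
      using ev[of "(c' - a') / 2"] by (auto elim: eventually_mono)
    then show ?thesis
    proof eventually_elim
      case (elim n)
      show ?case
      proof (rule ccontr)
        assume "\<not> a < f n"
        then have "c \<le> a + ennreal ((c' - a') / 2)"
          using elim by (meson add_right_mono not_less order_trans)
        also have "\<dots> = ennreal (a' + (c' - a') / 2)"
          using a' \<open>a' < c'\<close> by (simp add: ennreal_plus)
        finally show False using c' a' \<open>a' < c'\<close> by (simp add: ennreal_le_iff field_simps)
      qed
    qed
  qed
  show "\<forall>\<^sub>F n in F. f n < a" if a: "c < a" for a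
  proof -
    \<comment> \<open>\<open>a\<close> may be infinite; a finite \<open>b\<close> in between
      provides a real gap.\<close>
    obtain b where b: "c < b" "b < a" using dense[OF a] by blast
    then obtain b' where b': "b = ennreal b'" "0 \<le> b'" by (cases b) auto
    then have "c' < b'" using b c' by (simp add: ennreal_less_iff)
    then have "\<forall>\<^sub>F n in F. f n \<le> c + ennreal (b' - c')"
      using ev[of "b' - c'"] by (auto elim: eventually_mono)
    then show ?thesis
    proof eventually_elim
      case (elim n)
      also have "c + ennreal (b' - c') = b"
        using c' b' \<open>c' < b'\<close> by (simp add: ennreal_plus[symmetric] del: ennreal_plus)
      finally show ?case using b(2) by simp
    qed
  qed
qed

text \<open>The order of choice matters: \<open>r\<close> and \<open>M\<close> without regard to
  \<delta>, \<theta> from \<delta> and \<open>M\<close>, the errors from \<theta>, \<eta> from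
  \<open>M\<close> and \<open>\<epsilon>2\<close>, \<open>L\<close> from \<eta>, the cell size
  \<open>s\<close> from \<open>L\<close>, and \<open>n\<close> only after the partition is
  fixed.\<close>

lemma optimal_cost_eventually_close:
  fixes \<rho> :: "'a::euclidean_space measure"
  assumes N: "N > 1" and cont: "continuous_on {0<..} \<phi>"
    and \<phi>0: "\<And>a. 0 < a \<Longrightarrow> 0 \<le> \<phi> a" and anti: "\<And>a b. 0 < a \<Longrightarrow> a \<le> b \<Longrightarrow> \<phi> b \<le> \<phi> a"
    and lim: "filterlim \<phi> at_top (at_right 0)"
    and \<rho>s: "\<And>n. \<rho>s n \<in> borel_probs" and \<rho>: "\<rho> \<in> borel_probs"
    and conv: "narrowly_converges \<rho>s \<rho>"
    and conc: "(concentration \<rho> \<longlongrightarrow> l) (at_right 0)" "2 * (real N - 1) * l < 1"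
    and C1: "\<phi> C1_differentiable_on {0<..}" "\<forall>t>0. \<exists>k. \<forall>s>t. \<bar>deriv \<phi> s\<bar> < k"
    and \<delta>: "0 < \<delta>"
  shows "\<forall>\<^sub>F n in sequentially. optimal_cost \<phi> N (\<rho>s n) \<le> optimal_cost \<phi> N \<rho> + ennreal \<delta> \<and>
    optimal_cost \<phi> N \<rho> \<le> optimal_cost \<phi> N (\<rho>s n) + ennreal \<delta> \<and> optimal_cost \<phi> N \<rho> < \<infinity>"
proof -
  define u where "u = 1 / (2 * (real N - 1))"
  have N1: "0 < real N - 1" using N by simp
  \<comment> \<open>Truncation at 0 ensures that the later constant \<open>l0 + 3 * g\<close> is
    nonnegative.\<close>
  define l0 where "l0 = max l 0"
  have "l < u" using conc(2) N1 by (simp add: u_def field_simps)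
  moreover have "0 < u" using N1 by (simp add: u_def)
  ultimately have "l0 < u" by (simp add: l0_def)
  \<comment> \<open>A quarter of the gap: one \<open>g\<close> for the concentration at radius
    \<open>4 * r\<close>, one shared by tail and convergence, one for the errors compared with
    \<theta>, and one to keep \<open>l0 + 3 * g < u\<close> strict.\<close>
  define g where "g = (u - l0) / 4"
  have g: "0 < g" using \<open>l0 < u\<close> by (simp add: g_def)
  have \<kappa>u: "2 * (real N - 1) * k < 1" if "k < u" for k
    using that N1 by (simp add: u_def field_simps)
  have l0: "0 \<le> l0" "l \<le> l0" by (auto simp: l0_def)
  have "l0 + 3 * g < u" "l0 + 2 * g < u"
    using \<open>l0 < u\<close> by (simp_all add: g_def field_simps)
  note \<kappa>3 = \<kappa>u[OF this(1)] and \<kappa>2 = \<kappa>u[OF this(2)]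
  have "l < l0 + g" using l0 g by simp
  then have "\<forall>\<^sub>F r in at_right 0. concentration \<rho> r < l0 + g"
    by (rule order_tendstoD(2)[OF conc(1)])
  then obtain r0 where r0: "0 < r0" "\<And>r. 0 < r \<Longrightarrow> r < r0 \<Longrightarrow> concentration \<rho> r < l0 + g"
    unfolding eventually_at_right_field by auto
  define r where "r = r0 / 8"
  have r: "0 < r" and conc_r: "concentration \<rho> (4 * r) < l0 + g"
    using r0(1) r0(2)[of "4 * r"] by (auto simp: r_def)
  define M where "M = real (N\<^sup>2) * \<phi> r"
  have M: "0 \<le> M" using \<phi>0[OF r] by (simp add: M_def)
  \<comment> \<open>The filling will have mass at most \<open>2 * \<theta>\<close> and should cost
    at most \<open>\<delta> / 2\<close>; \<open>M + 1\<close> guards against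
    \<open>M = 0\<close>.\<close>
  define \<theta> where "\<theta> = min 1 (\<delta> / (4 * (M + 1)))"
  have \<theta>: "0 < \<theta>" "\<theta> \<le> 1" using \<delta> M by (auto simp: \<theta>_def)
  have \<theta>M: "2 * \<theta> * M \<le> \<delta> / 2"
  proof -
    have "2 * \<theta> * M \<le> 2 * (\<delta> / (4 * (M + 1))) * (M + 1)"
      using M \<delta> by (intro mult_mono) (auto simp: \<theta>_def)
    also have "\<dots> = \<delta> / 2" using M by (simp add: field_simps)
    finally show ?thesis .
  qed
  \<comment> \<open>\<open>\<epsilon> + \<epsilon>'\<close> is at most \<open>\<theta> * g\<close>,
    the room between \<theta> times \<open>l0 + 2 * g\<close> and \<theta> times
    \<open>l0 + 3 * g\<close>.\<close>
  define \<epsilon> where "\<epsilon> = min \<theta> (\<theta> * g / 2)"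
  define \<epsilon>' where "\<epsilon>' = min (g / 2) (\<theta> * g / 2)"
  define \<epsilon>1 where "\<epsilon>1 = \<epsilon> / (2 * real N)"
  define \<epsilon>2 where "\<epsilon>2 = \<epsilon> / 2"
  have \<epsilon>: "0 < \<epsilon>" "0 < \<epsilon>'" "\<epsilon> \<le> \<theta>" "\<epsilon> \<le> \<theta> * g / 2" "\<epsilon>' \<le> g / 2" "\<epsilon>' \<le> \<theta> * g / 2"
    using \<theta> g by (auto simp: \<epsilon>_def \<epsilon>'_def)
  have \<epsilon>12: "0 < \<epsilon>1" "0 < \<epsilon>2" "real N * \<epsilon>1 + \<epsilon>2 \<le> \<epsilon>"
    using \<epsilon> N by (auto simp: \<epsilon>1_def \<epsilon>2_def)
  have \<kappa>\<theta>: "\<theta> * (l0 + 2 * g) + \<epsilon>' + \<epsilon> \<le> (l0 + 3 * g) * \<theta>"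
    using \<epsilon>(4,6) by (simp add: algebra_simps)
  have "\<forall>\<^sub>F t in at_right 0. M / \<epsilon>2 + 1 \<le> \<phi> t"
    using lim by (simp add: filterlim_at_top)
  moreover have "\<forall>\<^sub>F t in at_right 0. (0::real) < t"
    by (rule eventually_at_right_less)
  ultimately have "\<forall>\<^sub>F t in at_right 0. M / \<epsilon>2 + 1 \<le> \<phi> t \<and> 0 < t"
    by (rule eventually_conj)
  then have "\<exists>t. M / \<epsilon>2 + 1 \<le> \<phi> t \<and> 0 < t"
    by (rule eventually_happens'[OF trivial_limit_at_right_real])
  \<comment> \<open>A plan of cost at most \<open>M\<close> then gives boxes without separated
    points a weight of at most \<open>\<epsilon>2\<close>; the summand 1 keeps
    \<open>\<phi> \<eta>\<close> positive when \<open>M = 0\<close>.\<close>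
  then obtain \<eta> where \<eta>: "0 < \<eta>" "M / \<epsilon>2 + 1 \<le> \<phi> \<eta>" by blast
  have "0 \<le> M / \<epsilon>2" using M \<epsilon>12 by simp
  then have \<phi>\<eta>: "0 < \<phi> \<eta>" using \<eta> by linarith
  have "M / \<epsilon>2 \<le> \<phi> \<eta>" using \<eta> by simp
  then have M_le: "M \<le> \<phi> \<eta> * \<epsilon>2" using \<epsilon>12 by (simp add: pos_divide_le_eq)
  obtain L where L: "0 < L" "\<And>a b. \<eta> / 2 \<le> a \<Longrightarrow> \<eta> / 2 \<le> b \<Longrightarrow> \<bar>\<phi> a - \<phi> b\<bar> \<le> L * \<bar>a - b\<bar>"
    using lipschitz_away_from_zero[OF C1, of "\<eta> / 2"] \<eta>(1) by auto
  \<comment> \<open>\<open>r\<close> serves the neighbourhood bound, \<open>\<eta> / 8\<close> the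
    diameter \<open>2 * s\<close> of the cells, and the last term an oscillation of at most
    \<open>\<delta> / 2\<close>.\<close>
  define s where "s = min (min r (\<eta> / 8)) (\<delta> / (8 * real (N\<^sup>2) * L))"
  have s: "0 < s" "s \<le> r" "4 * (2 * s) \<le> \<eta>"
    using r \<eta>(1) \<delta> L(1) N by (auto simp: s_def)
  have sL: "real (N\<^sup>2) * (L * (2 * (2 * s))) \<le> \<delta> / 2"
  proof -
    have "s \<le> \<delta> / (8 * real (N\<^sup>2) * L)" by (simp add: s_def)
    then have "s * (8 * real (N\<^sup>2) * L) \<le> \<delta>" using L(1) N by (simp add: pos_le_divide_eq)
    then show ?thesis by (simp add: algebra_simps)
  qed
  obtain R' where R': "measure \<rho> {x. R' < norm x} < min (g / 2) \<epsilon>1"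
    using tail_measure_small[OF \<rho>, of "min (g / 2) \<epsilon>1"] g \<epsilon>12 by auto
  \<comment> \<open>Neighbours of the cell near infinity reach inwards by up to \<open>3 * r\<close>
    and must still lie in the small tail.\<close>
  define R where "R = R' + 3 * r"
  have R: "measure \<rho> {x. R - 3 * r < norm x} < min (g / 2) \<epsilon>1" using R' by (simp add: R_def)
  obtain K and \<psi> :: "'a option \<Rightarrow> 'a \<Rightarrow> real" where pou: "partition_of_unity K \<psi>"
    and \<psi>_cont: "\<And>a. continuous_on UNIV (\<psi> a)"
    and \<psi>_Some: "\<And>z x. 0 < \<psi> (Some z) x \<Longrightarrow> dist z x < s"
    and \<psi>_None: "\<And>x. 0 < \<psi> None x \<Longrightarrow> R < norm x"
    using exists_partition_of_unity[OF s(1), of R] by metis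
  interpret partition_of_unity K \<psi> by (rule pou)
  let ?m = "cell_mass \<rho>"
  let ?near = "\<lambda>a. {b. b \<in> K \<and> close_cells r a b}"
  \<comment> \<open>A cell that is null for \<rho> may have positive mass for every
    \<open>\<rho>s n\<close>, so masses cannot be compared there by a factor. Such cells join
    \<open>None\<close>; as they are finitely many, the mass of \<open>B\<close> still converges to
    a value below \<open>\<epsilon>1\<close>.\<close>
  define B where "B = {a \<in> K. a = None \<or> ?m a = 0}"
  have B: "B \<subseteq> K" by (auto simp: B_def)
  have mass_B: "(\<Sum>a\<in>B. ?m a) < \<epsilon>1"
  proof -
    have "(\<Sum>a\<in>B. ?m a) = (\<Sum>a\<in>B \<inter> {None}. ?m a)"
      by (intro sum.mono_neutral_right) (use finite_K in \<open>auto simp: B_def\<close>)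
    also have "\<dots> \<le> measure \<rho> {x. R - 3 * r < norm x}"
    proof (rule sum_cell_mass_le_measure[OF \<rho>])
      show "{x::'a. R - 3 * r < norm x} \<in> sets borel"
        by (intro borel_open open_Collect_less continuous_intros)
      show "x \<in> {x. R - 3 * r < norm x}" if "a \<in> B \<inter> {None}" "0 < \<psi> a x" for a x
        using that \<psi>_None[of x] r by auto
    qed (auto simp: B_def)
    finally show ?thesis using R by simp
  qed
  have near_\<rho>: "(\<Sum>b\<in>?near a. ?m b) \<le> l0 + g + g / 2" for a
    using close_cells_mass_le[OF pou \<psi>_Some \<psi>_None s(1,2) \<rho>, of a] conc_r R by simp
  have tendsto: "(\<lambda>n. cell_mass (\<rho>s n) a) \<longlonglongrightarrow> ?m a" if "a \<in> K" for a
  proof -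
    have "bounded (range (\<psi> a))"
      unfolding bounded_iff using \<psi>_nonneg \<psi>_le_1[OF that] by (intro exI[of _ 1]) auto
    then show ?thesis
      using conv \<psi>_cont unfolding narrowly_converges_def cell_mass_def by blast
  qed
  have diam: "norm (x - y) \<le> 2 * s" if "a \<in> K - B" "0 < \<psi> a x" "0 < \<psi> a y" for a x y
  proof -
    have "a \<noteq> None" using that(1) by (auto simp: B_def)
    then obtain z where "a = Some z" by auto
    then have "dist z x < s" "dist z y < s" using \<psi>_Some that by auto
    then have "dist x y < 2 * s"
      using dist_triangle[of x y z] by (simp add: dist_commute)
    then show ?thesis by (simp add: dist_norm)
  qed
  have key: "optimal_cost \<phi> N \<nu> \<le> optimal_cost \<phi> N \<mu> + ennreal \<delta>"
    if \<mu>: "\<mu> \<in> borel_probs" and \<nu>: "\<nu> \<in> borel_probs"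
      and B_mass: "(\<Sum>a\<in>B. cell_mass \<mu> a) \<le> \<epsilon>1"
      and good: "\<And>a. a \<in> K - B \<Longrightarrow> (1 - \<theta>) * cell_mass \<mu> a \<le> cell_mass \<nu> a"
      and nbhd: "\<And>a. a \<in> K \<Longrightarrow> (\<Sum>b\<in>?near a. cell_mass \<nu> b) \<le> l0 + 2 * g"
      and diff: "\<And>a. a \<in> K \<Longrightarrow> (\<Sum>b\<in>?near a. cell_mass \<nu> b) \<le> (\<Sum>b\<in>?near a. cell_mass \<mu> b) + \<epsilon>'"
    for \<mu> \<nu>
  proof -
    have bound: "optimal_cost \<phi> N \<nu> \<le> ennreal M"
      unfolding M_def using N
      by (intro optimal_cost_bound[OF \<nu> _ cont \<phi>0 anti r nbhd \<kappa>2]) auto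
    have "optimal_cost \<phi> N \<nu> \<le> (\<integral>\<^sup>+x. cost \<phi> N x \<partial>P) + ennreal \<delta>"
      if P: "P \<in> transport_plans N \<mu>" for P
    \<comment> \<open>Plans costing more than \<open>M\<close> already exceed
      \<open>optimal_cost \<phi> N \<nu>\<close>; the others have the cost bound needed for Markov's
      inequality.\<close>
    proof (cases "(\<integral>\<^sup>+x. cost \<phi> N x \<partial>P) \<le> ennreal M")
      case True
      then have cost_P: "(\<integral>\<^sup>+x. cost \<phi> N x \<partial>P) \<le> ennreal (\<phi> \<eta> * \<epsilon>2)"
        using M_le by (meson ennreal_leI order_trans)
      have "optimal_cost \<phi> N \<nu> \<le> (\<integral>\<^sup>+x. cost \<phi> N x \<partial>P)
          + ennreal (real (N\<^sup>2) * (L * (2 * (2 * s)))) + ennreal ((\<theta> + \<epsilon>) * (real (N\<^sup>2) * \<phi> r))"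
      proof (rule optimal_cost_le_plan_cost[OF \<mu> \<nu> _ cont \<phi>0 anti r P cost_P \<eta>(1) \<phi>\<eta> _ _ L(2)
            diam _ s(3) B B_mass \<theta> good \<epsilon>12(3) nbhd diff _ _ \<kappa>\<theta> \<kappa>3])
        show "0 < N" "0 \<le> \<epsilon>2" "0 \<le> L" "0 \<le> 2 * s" "0 \<le> \<epsilon>'" "0 \<le> l0 + 3 * g"
          using N \<epsilon>12 L s \<epsilon> l0 g by auto
      qed
      also have "\<dots> \<le> (\<integral>\<^sup>+x. cost \<phi> N x \<partial>P) + ennreal (\<delta> / 2) + ennreal (\<delta> / 2)"
      proof (intro add_mono ennreal_leI order_refl sL)
        have "(\<theta> + \<epsilon>) * M \<le> (2 * \<theta>) * M"
          using M \<epsilon>(3) by (intro mult_right_mono) auto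
        then show "(\<theta> + \<epsilon>) * (real (N\<^sup>2) * \<phi> r) \<le> \<delta> / 2"
          using \<theta>M by (simp add: M_def)
      qed
      also have "\<dots> = (\<integral>\<^sup>+x. cost \<phi> N x \<partial>P) + ennreal \<delta>"
        using \<delta> by (simp add: add.assoc ennreal_plus[symmetric] del: ennreal_plus)
      finally show ?thesis .
    next
      case False
      then have "optimal_cost \<phi> N \<nu> \<le> (\<integral>\<^sup>+x. cost \<phi> N x \<partial>P)"
        using bound by (meson linear order_trans)
      then show ?thesis by (simp add: add_increasing2)
    qed
    then have "optimal_cost \<phi> N \<nu> - ennreal \<delta> \<le> (\<integral>\<^sup>+x. cost \<phi> N x \<partial>P)"
      if "P \<in> transport_plans N \<mu>" for P
      using that by (simp add: ennreal_minus_le_iff add.commute)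
    then have "optimal_cost \<phi> N \<nu> - ennreal \<delta> \<le> optimal_cost \<phi> N \<mu>"
      by (subst (2) optimal_cost_def) (rule INF_greatest)
    then show ?thesis by (simp add: ennreal_minus_le_iff add.commute)
  qed
  have fin: "optimal_cost \<phi> N \<rho> < \<infinity>"
  proof -
    have "optimal_cost \<phi> N \<rho> \<le> ennreal M"
      unfolding M_def
    proof (rule optimal_cost_bound[OF \<rho> _ cont \<phi>0 anti r _ \<kappa>2])
      show "(\<Sum>b\<in>?near a. ?m b) \<le> l0 + 2 * g" for a using near_\<rho>[of a] g by simp
    qed (use N in auto)
    then show ?thesis by (simp add: order_le_less_trans)
  qed
  have ev_B: "\<forall>\<^sub>F n in sequentially. (\<Sum>a\<in>B. cell_mass (\<rho>s n) a) < \<epsilon>1"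
    by (rule order_tendstoD(2)[OF _ mass_B]) (use B in \<open>auto intro!: tendsto_sum tendsto\<close>)
  \<comment> \<open>Off \<open>B\<close> the limit mass is positive, so the factor 1 - \<theta>
    leaves a strict gap in both directions.\<close>
  have ev_good: "\<forall>\<^sub>F n in sequentially. \<forall>a\<in>K - B.
      (1 - \<theta>) * ?m a < cell_mass (\<rho>s n) a \<and> (1 - \<theta>) * cell_mass (\<rho>s n) a < ?m a"
  proof (intro eventually_ball_finite ballI eventually_conj)
    fix a assume a: "a \<in> K - B"
    then have "0 < ?m a" using cell_mass_nonneg[of \<rho> a] by (auto simp: B_def less_le)
    then have less: "(1 - \<theta>) * ?m a < ?m a" using \<theta> by (simp add: mult_less_cancel_right2)
    have lim_a: "(\<lambda>n. cell_mass (\<rho>s n) a) \<longlonglongrightarrow> ?m a" using a by (intro tendsto) auto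
    show "\<forall>\<^sub>F n in sequentially. (1 - \<theta>) * ?m a < cell_mass (\<rho>s n) a"
      by (rule order_tendstoD(1)[OF lim_a less])
    show "\<forall>\<^sub>F n in sequentially. (1 - \<theta>) * cell_mass (\<rho>s n) a < ?m a"
      by (rule order_tendstoD(2)[OF tendsto_mult_left[OF lim_a] less])
  qed (use finite_K in auto)
  have ev_near: "\<forall>\<^sub>F n in sequentially. \<forall>a\<in>K.
      dist (\<Sum>b\<in>?near a. cell_mass (\<rho>s n) b) (\<Sum>b\<in>?near a. ?m b) < \<epsilon>'"
    by (intro eventually_ball_finite ballI finite_K tendstoD \<epsilon>(2) tendsto_sum tendsto) auto
  show ?thesis
    using ev_B ev_good ev_near
  proof eventually_elim
    case (elim n)
    have near: "\<bar>(\<Sum>b\<in>?near a. cell_mass (\<rho>s n) b) - (\<Sum>b\<in>?near a. ?m b)\<bar> < \<epsilon>'" if "a \<in> K" for a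
      using elim(3) that by (simp add: dist_real_def)
    have "optimal_cost \<phi> N (\<rho>s n) \<le> optimal_cost \<phi> N \<rho> + ennreal \<delta>"
    proof (rule key[OF \<rho> \<rho>s])
      show "(\<Sum>b\<in>?near a. cell_mass (\<rho>s n) b) \<le> l0 + 2 * g"
        "(\<Sum>b\<in>?near a. cell_mass (\<rho>s n) b) \<le> (\<Sum>b\<in>?near a. ?m b) + \<epsilon>'" if "a \<in> K" for a
        using near[OF that] near_\<rho>[of a] \<epsilon>(5) by linarith+
    qed (use mass_B elim(2) in \<open>auto simp: less_imp_le\<close>)
    moreover have "optimal_cost \<phi> N \<rho> \<le> optimal_cost \<phi> N (\<rho>s n) + ennreal \<delta>"
    proof (rule key[OF \<rho>s \<rho>])
      show "(\<Sum>b\<in>?near a. ?m b) \<le> l0 + 2 * g"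
        "(\<Sum>b\<in>?near a. ?m b) \<le> (\<Sum>b\<in>?near a. cell_mass (\<rho>s n) b) + \<epsilon>'" if "a \<in> K" for a
        using near[OF that] near_\<rho>[of a] g by linarith+
    qed (use elim(1,2) in \<open>auto simp: less_imp_le\<close>)
    ultimately show ?case using fin by blast
  qed
qed

theorem theorem3p9:
  fixes N :: nat
    and \<phi> :: "real \<Rightarrow> real"
    and \<rho>s :: "nat \<Rightarrow> (real ^ 3) measure"
    and \<rho> :: "(real ^ 3) measure"
    and l :: real
  assumes "N > 1"
    and "continuous_on {0<..} \<phi>"
    and "\<forall>t>0. \<phi> t \<ge> 0"
    and "strict_antimono_on {0<..} \<phi>"
    and "filterlim \<phi> at_top (at_right 0)"
    and "\<forall>n. \<rho>s n \<in> borel_probs"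
    and "\<rho> \<in> borel_probs"
    and "narrowly_converges \<rho>s \<rho>"
    and "(concentration \<rho> \<longlongrightarrow> l) (at_right 0)"
    and "l < 1 / (real N * (real N - 1)\<^sup>2)"
    and "\<phi> C1_differentiable_on {0<..}"
    and "\<forall>t>0. \<exists>k. \<forall>s>t. \<bar>deriv \<phi> s\<bar> < k"
  shows "(\<lambda>n. optimal_cost \<phi> N (\<rho>s n)) \<longlonglongrightarrow> optimal_cost \<phi> N \<rho>"
proof -
  have anti: "\<phi> b \<le> \<phi> a" if "0 < a" "a \<le> b" for a b
    using assms(4) that by (cases "a = b") (auto simp: monotone_on_def less_imp_le)
  \<comment> \<open>For N \<ge> 2, N (N - 1)^2 is at least 2 (N - 1), with equality at N = 2. So the
    assumed threshold implies the one of the exchange argument.\<close>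
  have small: "2 * (real N - 1) * l < 1"
  proof -
    have N1: "1 \<le> real N - 1" "2 \<le> real N" using assms(1) by auto
    have "2 * (real N - 1) \<le> real N * (real N - 1)\<^sup>2"
      using N1 mult_mono[of 2 "real N" "real N - 1" "(real N - 1)\<^sup>2"] self_le_power[of "real N - 1" 2] by simp
    then have "1 / (real N * (real N - 1)\<^sup>2) \<le> 1 / (2 * (real N - 1))"
      using N1 by (intro divide_left_mono mult_pos_pos) auto
    then have "l < 1 / (2 * (real N - 1))" using assms(10) by linarith
    then show ?thesis using N1 by (simp add: pos_less_divide_eq mult.commute)
  qed
  have close: "\<forall>\<^sub>F n in sequentially. optimal_cost \<phi> N (\<rho>s n) \<le> optimal_cost \<phi> N \<rho> + ennreal \<delta> \<and>
      optimal_cost \<phi> N \<rho> \<le> optimal_cost \<phi> N (\<rho>s n) + ennreal \<delta> \<and> optimal_cost \<phi> N \<rho> < \<infinity>"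
    if "0 < \<delta>" for \<delta>
    using assms that
    by (intro optimal_cost_eventually_close[where l = l] anti small) auto
  show ?thesis
  proof (rule ennreal_tendstoI)
    show "optimal_cost \<phi> N \<rho> < \<infinity>"
      using eventually_happens[OF close[of 1]] by auto
    show "\<forall>\<^sub>F n in sequentially. optimal_cost \<phi> N (\<rho>s n) \<le> optimal_cost \<phi> N \<rho> + ennreal \<delta> \<and>
      optimal_cost \<phi> N \<rho> \<le> optimal_cost \<phi> N (\<rho>s n) + ennreal \<delta>" if "0 < \<delta>" for \<delta>
      using close[OF that] by (auto elim: eventually_mono)
  qed
qed

end
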